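(* Let $A$ be a recursively enumerable set of integers. Then there is a countably generated recursive presentation $Q$ of a group $\overline{Q}$ which is $A$-torsion-free and contains an embedded copy of every countably generated recursively presentable $A$-torsion-free group.
   Context: A countably generated recursive presentation $\langle X \mid R\rangle$ is a group presentation where $X$ is a recursively enumerated set of generators and $R$ is a recursive enumeration of relators; $\overline{P}$ denotes the group it presents. A group is countably generated recursively presentable if it is isomorphic to $\overline{P}$ for some countably generated recursive presentation $P$. For a group $G$ and set of integers $A$, $G$ is $A$-torsion-free if there is no $g \neq e$ in $G$ with $g^{n} = e$ for some $n \in A$. *)

theory Defs
  imports "HOL-Algebra.Algebra" "HOL-Library.Nat_Bijection"
begin

datatype recf = Zero | Succ | Proj nat | Comp recf "recf list" | Prec recf recf | Mn recf

inductive eval :: "recf \<Rightarrow> nat list \<Rightarrow> nat \<Rightarrow> bool" where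
  eval_Zero: "eval Zero xs 0"
| eval_Succ: "eval Succ (x # xs) (Suc x)"
| eval_Proj: "i < length xs \<Longrightarrow> eval (Proj i) xs (xs ! i)"
| eval_Comp: "list_all2 (\<lambda>g y. eval g xs y) gs ys \<Longrightarrow> eval f ys y \<Longrightarrow> eval (Comp f gs) xs y"
| eval_Prec0: "eval f xs y \<Longrightarrow> eval (Prec f g) (0 # xs) y"
| eval_PrecS: "eval (Prec f g) (n # xs) r \<Longrightarrow> eval g (n # r # xs) y \<Longrightarrow> eval (Prec f g) (Suc n # xs) y"
| eval_Mn: "eval f (n # xs) 0 \<Longrightarrow> (\<forall>m<n. \<exists>y. eval f (m # xs) (Suc y)) \<Longrightarrow> eval (Mn f) xs n"

definition re_set :: "nat set \<Rightarrow> bool" where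
  "re_set S \<longleftrightarrow> (\<exists>f. S = {x. \<exists>y. eval f [x] y})"

definition re_int_set :: "int set \<Rightarrow> bool" where
  "re_int_set A \<longleftrightarrow> re_set (int_encode ` A)"

text \<open>A letter (x, b) is the generator x if b = False and its inverse if b = True.\<close>
type_synonym word = "(nat \<times> bool) list"

definition words :: "nat set \<Rightarrow> word set" where
  "words Xs = {w. \<forall>l\<in>set w. fst l \<in> Xs}"

definition word_code :: "word \<Rightarrow> nat" where
  "word_code w = list_encode (map (\<lambda>(x, b). prod_encode (x, if b then 1 else 0)) w)"

inductive peq :: "nat set \<Rightarrow> word set \<Rightarrow> word \<Rightarrow> word \<Rightarrow> bool" for Xs R where
  peq_refl: "peq Xs R w w"
| peq_sym: "peq Xs R u v \<Longrightarrow> peq Xs R v u"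
| peq_trans: "peq Xs R u v \<Longrightarrow> peq Xs R v w \<Longrightarrow> peq Xs R u w"
| peq_cancel: "x \<in> Xs \<Longrightarrow> peq Xs R (u @ [(x, b), (x, \<not> b)] @ v) (u @ v)"
| peq_rel: "r \<in> R \<Longrightarrow> peq Xs R (u @ r @ v) (u @ v)"

definition grel :: "nat set \<Rightarrow> word set \<Rightarrow> (word \<times> word) set" where
  "grel Xs R = {(u, v). u \<in> words Xs \<and> v \<in> words Xs \<and> peq Xs R u v}"

type_synonym presentation = "nat set \<times> word set"

definition presented_group :: "presentation \<Rightarrow> word set monoid" where
  "presented_group P = (case P of (Xs, R) \<Rightarrow>
     \<lparr>carrier = words Xs // grel Xs R,
      monoid.mult = (\<lambda>a b. grel Xs R `` {(SOME u. u \<in> a) @ (SOME v. v \<in> b)}),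
      monoid.one = grel Xs R `` {[]}\<rparr>)"

definition cg_rec_presentation :: "presentation \<Rightarrow> bool" where
  "cg_rec_presentation P \<longleftrightarrow> (case P of (Xs, R) \<Rightarrow>
     re_set Xs \<and> re_set (word_code ` R) \<and> R \<subseteq> words Xs)"

definition cg_rec_presentable :: "('g, 'b) monoid_scheme \<Rightarrow> bool" where
  "cg_rec_presentable G \<longleftrightarrow> (\<exists>P. cg_rec_presentation P \<and> G \<cong> presented_group P)"

definition torsion_free_on :: "int set \<Rightarrow> ('g, 'b) monoid_scheme \<Rightarrow> bool" where
  "torsion_free_on A G \<longleftrightarrow>
     \<not> (\<exists>g\<in>carrier G. g \<noteq> \<one>\<^bsub>G\<^esub> \<and> (\<exists>n\<in>A. g [^]\<^bsub>G\<^esub> n = \<one>\<^bsub>G\<^esub>))"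

definition embeds_into :: "('g, 'b) monoid_scheme \<Rightarrow> ('h, 'c) monoid_scheme \<Rightarrow> bool" where
  "embeds_into G H \<longleftrightarrow> (\<exists>h. h \<in> hom G H \<and> inj_on h (carrier G))"

end

theory Submission
  imports Defs
begin

text \<open>
  Every presentation \<open>\<langle>X | R\<rangle>\<close> has a universal \<open>A\<close>-torsion-free quotient: close \<open>R\<close> under the
  rule that \<open>w\<close> becomes a relator once some \<open>w\<^sup>n\<close> with \<open>n\<close> in \<open>A\<close> is trivial modulo finitely many
  earlier relators. Apply this to the free product of all countably generated recursive
  presentations, whose \<open>i\<close>-th factor has the relators with codes in the \<open>i\<close>-th recursively
  enumerable set. If the \<open>i\<close>-th factor is \<open>A\<close>-torsion-free, then the retraction of the free product
  onto it kills all new relators, so the factor is a retract of the quotient and in particular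
  embeds.

  The presentation is recursive because a set generated by recursively enumerable finitary rules is
  recursively enumerable: derivations are finite and can be coded by numbers. The same principle
  applied to the evaluation of recursive functions yields the uniform enumeration of all recursively
  enumerable sets.
\<close>

section \<open>Recursive functions of environments\<close>

lemma list_all2_fun_unique:
  assumes "list_all2 (\<lambda>g y. \<forall>z. P g z \<longrightarrow> y = z) gs ys" "list_all2 P gs zs"
  shows "ys = zs"
  using assms by (induction gs arbitrary: ys zs) (auto simp: list_all2_Cons1)

lemma eval_deterministic: "eval f xs y \<Longrightarrow> eval f xs z \<Longrightarrow> y = z"
proof (induction arbitrary: z rule: eval.induct)
  case (eval_Comp xs gs ys f y)
  from eval_Comp.prems obtain zs where zs: "list_all2 (\<lambda>g y. eval g xs y) gs zs" "eval f zs z"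
    by (cases rule: eval.cases) auto
  have "list_all2 (\<lambda>g y. \<forall>z. eval g xs z \<longrightarrow> y = z) gs ys"
    using eval_Comp.IH(1) by (rule list_all2_mono) blast
  with zs(1) have "ys = zs" by (rule list_all2_fun_unique[rotated])
  with zs(2) eval_Comp.IH(2) show ?case by blast
next
  case (eval_Prec0 f xs y g)
  from eval_Prec0.prems have "eval f xs z" by (cases rule: eval.cases) auto
  with eval_Prec0.IH show ?case by blast
next
  case (eval_PrecS f g n xs r y)
  from eval_PrecS.prems obtain r' where "eval (Prec f g) (n # xs) r'" "eval g (n # r' # xs) z"
    by (cases rule: eval.cases) auto
  with eval_PrecS.IH show ?case by blast
next
  case (eval_Mn f n xs)
  from eval_Mn.prems have z: "eval f (z # xs) 0" "\<forall>m<z. \<exists>y. eval f (m # xs) (Suc y)"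
    by (cases rule: eval.cases; auto)+
  show ?case
  proof (rule linorder_cases[of n z])
    assume "n < z"
    with z(2) eval_Mn.IH(1) show ?thesis by blast
  next
    assume "z < n"
    with z(1) eval_Mn.IH(2) show ?thesis by blast
  qed
qed (auto elim: eval.cases)

lemma eval_Mn_iff:
  assumes r: "\<And>k. eval r (k # xs) (F k)"
  shows "eval (Mn r) xs y \<longleftrightarrow> F y = 0 \<and> (\<forall>k<y. F k \<noteq> 0)"
proof
  assume "eval (Mn r) xs y"
  then have "eval r (y # xs) 0" "\<forall>k<y. \<exists>z. eval r (k # xs) (Suc z)"
    by (cases rule: eval.cases; auto)+
  with eval_deterministic[OF r] show "F y = 0 \<and> (\<forall>k<y. F k \<noteq> 0)" by fastforce
next
  assume "F y = 0 \<and> (\<forall>k<y. F k \<noteq> 0)"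
  with r show "eval (Mn r) xs y" by (intro eval_Mn) (metis not0_implies_Suc)+
qed

text \<open>A function of several arguments is a function of an environment \<open>e\<close>, the variables being
  \<open>e 0\<close>, \<open>e 1\<close>, and so on. A fresh variable is bound by shifting the environment, so a body \<open>P x e\<close>
  is represented by \<open>P (e 0) (\<lambda>i. e (Suc i))\<close>.\<close>

definition recursive :: "((nat \<Rightarrow> nat) \<Rightarrow> nat) \<Rightarrow> bool" where
  "recursive f \<longleftrightarrow> (\<exists>r n. \<forall>e. \<forall>m\<ge>n. eval r (map e [0..<m]) (f e))"

lemma recursiveI: "(\<And>e m. n \<le> m \<Longrightarrow> eval r (map e [0..<m]) (f e)) \<Longrightarrow> recursive f"
  unfolding recursive_def by blast

lemma map_upt_Suc_shift: "map e [0..<Suc m] = e 0 # map (\<lambda>i. e (Suc i)) [0..<m]"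
  by (simp add: map_upt_Suc del: upt_Suc)

named_theorems recursive_intros

lemma recursive_var [recursive_intros]: "recursive (\<lambda>e. e i)"
proof (rule recursiveI)
  fix e :: "nat \<Rightarrow> nat" and m assume "Suc i \<le> m"
  then show "eval (Proj i) (map e [0..<m]) (e i)"
    using eval_Proj[of i "map e [0..<m]"] by simp
qed

lemma recursive_subst:
  assumes F: "recursive F" and g: "\<And>i. recursive (g i)"
  shows "recursive (\<lambda>e. F (\<lambda>i. g i e))"
proof -
  obtain r n where r: "\<And>e m. n \<le> m \<Longrightarrow> eval r (map e [0..<m]) (F e)"
    using F unfolding recursive_def by blast
  have "\<forall>i. \<exists>s k. \<forall>e. \<forall>m\<ge>k. eval s (map e [0..<m]) (g i e)"
    using g unfolding recursive_def by blast
  then obtain s k where s: "\<And>i e m. k i \<le> m \<Longrightarrow> eval (s i) (map e [0..<m]) (g i e)"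
    by metis
  show ?thesis
  proof (rule recursiveI)
    fix e :: "nat \<Rightarrow> nat" and m assume m: "(\<Sum>i<n. k i) \<le> m"
    have "k i \<le> m" if "i < n" for i
      using member_le_sum[of i "{..<n}" k] that m by simp
    then have "list_all2 (\<lambda>g y. eval g (map e [0..<m]) y) (map s [0..<n]) (map (\<lambda>i. g i e) [0..<n])"
      by (auto simp: list_all2_conv_all_nth s)
    then show "eval (Comp r (map s [0..<n])) (map e [0..<m]) (F (\<lambda>i. g i e))"
      using r[of n] by (rule eval_Comp) simp
  qed
qed

lemma recursive_shift: "recursive f \<Longrightarrow> recursive (\<lambda>e. f (\<lambda>i. e (Suc i)))"
  using recursive_subst[of f "\<lambda>i e. e (Suc i)"] by (simp add: recursive_var)

lemma recursive_subst1:
  assumes "recursive (\<lambda>e. F (e 0) (\<lambda>i. e (Suc i)))" "recursive f" "\<And>i. recursive (g i)"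
  shows "recursive (\<lambda>e. F (f e) (\<lambda>i. g i e))"
  using recursive_subst[OF assms(1), of "case_nat f g"] assms(2,3) by (simp split: nat.split)

lemma recursive_case_nat [recursive_intros]:
  assumes "recursive f" "\<And>i. recursive (g i)"
  shows "recursive (\<lambda>e. case_nat (f e) (\<lambda>i. g i e) n)"
  using assms by (cases n) simp_all

lemma recursive_Suc [recursive_intros]:
  assumes "recursive f"
  shows "recursive (\<lambda>e. Suc (f e))"
proof (rule recursive_subst1[where F = "\<lambda>x _. Suc x"])
  show "recursive (\<lambda>e. Suc (e 0))"
  proof (rule recursiveI)
    fix e :: "nat \<Rightarrow> nat" and m assume "Suc 0 \<le> m"
    then show "eval Succ (map e [0..<m]) (Suc (e 0))"
      by (cases m) (auto simp: map_upt_Suc_shift eval_Succ simp del: upt_Suc)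
  qed
qed (use assms in \<open>auto intro: recursive_var\<close>)

lemma recursive_const [recursive_intros]: "recursive (\<lambda>e. c)"
proof (induction c)
  case 0
  show ?case by (rule recursiveI) (rule eval_Zero)
qed (rule recursive_Suc)

lemma eval_Prec_rec_nat:
  assumes f: "eval f xs a" and g: "\<And>k r. eval g (k # r # xs) (h k r)"
  shows "eval (Prec f g) (k # xs) (rec_nat a h k)"
  by (induction k) (auto intro: eval_Prec0 eval_PrecS f g)

lemma recursive_rec_nat [recursive_intros]:
  assumes f: "recursive f"
    and g: "recursive (\<lambda>e. g (e 0) (e (Suc 0)) (\<lambda>i. e (Suc (Suc i))))"
    and h: "recursive h"
  shows "recursive (\<lambda>e. rec_nat (f e) (\<lambda>k r. g k r e) (h e))"
proof -
  obtain rf nf where rf: "\<And>e m. nf \<le> m \<Longrightarrow> eval rf (map e [0..<m]) (f e)"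
    using f unfolding recursive_def by blast
  obtain rg ng where rg: "\<And>e m. ng \<le> m \<Longrightarrow>
      eval rg (map e [0..<m]) (g (e 0) (e (Suc 0)) (\<lambda>i. e (Suc (Suc i))))"
    using g unfolding recursive_def by blast
  have rg_Cons: "eval rg (k # r # map e [0..<m]) (g k r e)" if "ng \<le> m" for k r e m
    using rg[of "Suc (Suc m)" "case_nat k (case_nat r e)"] that
    by (simp add: map_upt_Suc_shift del: upt_Suc)
  have "recursive (\<lambda>e. rec_nat (f (\<lambda>i. e (Suc i))) (\<lambda>k r. g k r (\<lambda>i. e (Suc i))) (e 0))"
  proof (rule recursiveI)
    fix e :: "nat \<Rightarrow> nat" and m assume "Suc (nf + ng) \<le> m"
    then obtain m' where m: "m = Suc m'" "nf \<le> m'" "ng \<le> m'" by (cases m) auto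
    show "eval (Prec rf rg) (map e [0..<m])
        (rec_nat (f (\<lambda>i. e (Suc i))) (\<lambda>k r. g k r (\<lambda>i. e (Suc i))) (e 0))"
      unfolding m(1) map_upt_Suc_shift by (intro eval_Prec_rec_nat rf rg_Cons m)
  qed
  from recursive_subst1[of "\<lambda>x e. rec_nat (f e) (\<lambda>k r. g k r e) x", OF this h recursive_var]
  show ?thesis .
qed

lemma recursive_add [recursive_intros]:
  assumes "recursive f" "recursive g"
  shows "recursive (\<lambda>e. f e + g e)"
proof -
  have "rec_nat a (\<lambda>_ r. Suc r) b = a + b" for a b by (induction b) auto
  moreover have "recursive (\<lambda>e. rec_nat (f e) (\<lambda>_ r. Suc r) (g e))"
    by (intro recursive_intros assms)
  ultimately show ?thesis by simp
qed

lemma recursive_pred [recursive_intros]: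
  assumes "recursive f"
  shows "recursive (\<lambda>e. f e - Suc 0)"
proof -
  have "rec_nat 0 (\<lambda>k _. k) b = b - Suc 0" for b by (cases b) auto
  moreover have "recursive (\<lambda>e. rec_nat 0 (\<lambda>k _. k) (f e))"
    by (intro recursive_intros assms)
  ultimately show ?thesis by simp
qed

lemma recursive_diff [recursive_intros]:
  assumes "recursive f" "recursive g"
  shows "recursive (\<lambda>e. f e - g e)"
proof -
  have "rec_nat a (\<lambda>_ r. r - Suc 0) b = a - b" for a b by (induction b) auto
  moreover have "recursive (\<lambda>e. rec_nat (f e) (\<lambda>_ r. r - Suc 0) (g e))"
    by (intro recursive_intros assms)
  ultimately show ?thesis by simp
qed

lemma recursive_triangle [recursive_intros]:
  assumes "recursive f"
  shows "recursive (\<lambda>e. triangle (f e))"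
proof -
  have "rec_nat 0 (\<lambda>k r. r + Suc k) b = triangle b" for b by (induction b) auto
  moreover have "recursive (\<lambda>e. rec_nat 0 (\<lambda>k r. r + Suc k) (f e))"
    by (intro recursive_intros assms)
  ultimately show ?thesis by simp
qed

lemma recursive_prod_encode [recursive_intros]:
  "recursive f \<Longrightarrow> recursive g \<Longrightarrow> recursive (\<lambda>e. prod_encode (f e, g e))"
  by (simp add: prod_encode_def recursive_add recursive_triangle)

section \<open>Decidable predicates\<close>

definition decidable :: "((nat \<Rightarrow> nat) \<Rightarrow> bool) \<Rightarrow> bool" where
  "decidable P \<longleftrightarrow> recursive (\<lambda>e. of_bool (P e))"

lemma decidable_subst1:
  assumes "decidable (\<lambda>e. P (e 0) (\<lambda>i. e (Suc i)))" "recursive f" "\<And>i. recursive (g i)"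
  shows "decidable (\<lambda>e. P (f e) (\<lambda>i. g i e))"
  using recursive_subst1[of "\<lambda>x e. of_bool (P x e)"] assms unfolding decidable_def .

lemma recursive_If [recursive_intros]:
  assumes "decidable P" "recursive f" "recursive g"
  shows "recursive (\<lambda>e. if P e then f e else g e)"
proof -
  have "rec_nat b (\<lambda>_ _. a) (of_bool Q) = (if Q then a else b)" for a b :: nat and Q by simp
  moreover have "recursive (\<lambda>e. rec_nat (g e) (\<lambda>_ _. f e) (of_bool (P e)))"
    using assms by (intro recursive_rec_nat recursive_shift) (auto simp: decidable_def)
  ultimately show ?thesis by simp
qed

lemma decidable_const [recursive_intros]: "decidable (\<lambda>e. P)"
  unfolding decidable_def by (rule recursive_const)

lemma decidable_If:
  assumes "decidable P" "decidable Q" "decidable R"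
  shows "decidable (\<lambda>e. if P e then Q e else R e)"
proof -
  have "recursive (\<lambda>e. if P e then of_bool (Q e) else of_bool (R e))"
    using assms by (intro recursive_If) (simp_all add: decidable_def)
  moreover have "(if P e then of_bool (Q e) else of_bool (R e)) =
      (of_bool (if P e then Q e else R e) :: nat)" for e by simp
  ultimately show ?thesis by (simp add: decidable_def)
qed

lemma decidable_not [recursive_intros]: "decidable P \<Longrightarrow> decidable (\<lambda>e. \<not> P e)"
  using decidable_If[of P "\<lambda>_. False" "\<lambda>_. True"] by (simp add: decidable_const if_bool_eq_conj)

lemma decidable_conj [recursive_intros]: "decidable P \<Longrightarrow> decidable Q \<Longrightarrow> decidable (\<lambda>e. P e \<and> Q e)"
  using decidable_If[of P Q "\<lambda>_. False"] by (simp add: decidable_const if_bool_eq_disj)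

lemma decidable_disj [recursive_intros]: "decidable P \<Longrightarrow> decidable Q \<Longrightarrow> decidable (\<lambda>e. P e \<or> Q e)"
  using decidable_If[of P "\<lambda>_. True" Q] by (simp add: decidable_const if_bool_eq_conj imp_conv_disj)

lemma decidable_eq_0:
  assumes "recursive f"
  shows "decidable (\<lambda>e. f e = 0)"
proof -
  have "rec_nat 1 (\<lambda>_ _. 0) n = (of_bool (n = 0) :: nat)" for n by (cases n) auto
  moreover have "recursive (\<lambda>e. rec_nat 1 (\<lambda>_ _. 0) (f e))"
    by (intro recursive_intros assms)
  ultimately show ?thesis by (simp add: decidable_def)
qed

lemma decidable_le [recursive_intros]:
  "recursive f \<Longrightarrow> recursive g \<Longrightarrow> decidable (\<lambda>e. f e \<le> g e)"
  using decidable_eq_0[OF recursive_diff] by simp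

lemma decidable_eq [recursive_intros]:
  "recursive f \<Longrightarrow> recursive g \<Longrightarrow> decidable (\<lambda>e. f e = g e)"
  using decidable_conj[OF decidable_le[of f g] decidable_le[of g f]] by (simp add: eq_iff)

lemma decidable_bex_less:
  assumes P: "decidable (\<lambda>e. P (e 0) (\<lambda>i. e (Suc i)))" and b: "recursive b"
  shows "decidable (\<lambda>e. \<exists>k<b e. P k e)"
proof -
  have "rec_nat 0 (\<lambda>k r. if Q k then 1 else r) n = (of_bool (\<exists>k<n. Q k) :: nat)" for Q n
    by (induction n) (auto simp: less_Suc_eq)
  moreover have "recursive (\<lambda>e. rec_nat 0 (\<lambda>k r. if P k e then 1 else r) (b e))"
    by (intro recursive_intros decidable_subst1[OF P] b)
  ultimately show ?thesis by (simp add: decidable_def)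
qed

lemma recursive_if_decidable_graph:
  assumes "decidable (\<lambda>e. e 0 = f (\<lambda>i. e (Suc i)))"
  shows "recursive f"
proof -
  have "recursive (\<lambda>e. of_bool (e 0 \<noteq> f (\<lambda>i. e (Suc i))))"
    using decidable_not[OF assms] by (simp add: decidable_def)
  then obtain r n where r: "\<And>e m. n \<le> m \<Longrightarrow>
      eval r (map e [0..<m]) (of_bool (e 0 \<noteq> f (\<lambda>i. e (Suc i))))"
    unfolding recursive_def by blast
  show ?thesis
  proof (rule recursiveI)
    fix e :: "nat \<Rightarrow> nat" and m assume "n \<le> m"
    then have "eval r (k # map e [0..<m]) (of_bool (k \<noteq> f e))" for k
      using r[of "Suc m" "case_nat k e"] by (simp add: map_upt_Suc_shift del: upt_Suc)
    from eval_Mn_iff[OF this] show "eval (Mn r) (map e [0..<m]) (f e)" by simp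
  qed
qed

abbreviation pfst :: "nat \<Rightarrow> nat" where "pfst n \<equiv> fst (prod_decode n)"
abbreviation psnd :: "nat \<Rightarrow> nat" where "psnd n \<equiv> snd (prod_decode n)"

lemma recursive_pfst [recursive_intros]:
  assumes "recursive f"
  shows "recursive (\<lambda>e. pfst (f e))"
proof (rule recursive_if_decidable_graph)
  have "a = pfst n \<longleftrightarrow> (\<exists>b<Suc n. n = prod_encode (a, b))" for a n
    using le_prod_encode_2[of "psnd n" "pfst n"] by (auto simp: less_Suc_eq_le)
  then show "decidable (\<lambda>e. e 0 = pfst (f (\<lambda>i. e (Suc i))))"
    by simp (intro decidable_bex_less recursive_intros recursive_shift assms)
qed

lemma recursive_psnd [recursive_intros]:
  assumes "recursive f"
  shows "recursive (\<lambda>e. psnd (f e))"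
proof (rule recursive_if_decidable_graph)
  have "b = psnd n \<longleftrightarrow> prod_encode (pfst n, b) = n" for b n
    by (metis prod.collapse prod_decode_inverse prod_encode_inverse snd_conv)
  then show "decidable (\<lambda>e. e 0 = psnd (f (\<lambda>i. e (Suc i))))"
    by simp (intro recursive_intros recursive_shift assms)
qed

lemma list_encode_tl: "list_encode (tl xs) = psnd (list_encode xs - Suc 0)"
proof (cases xs)
  case Nil
  have "prod_decode 0 = (0, 0)" by (simp add: prod_decode_def prod_decode_aux.simps)
  with Nil show ?thesis by simp
qed simp

lemma length_le_list_encode: "length xs \<le> list_encode xs"
proof (induction xs)
  case (Cons x xs)
  have "list_encode xs \<le> prod_encode (x, list_encode xs)" by (rule le_prod_encode_2)
  with Cons show ?case by simp
qed simp

lemma recursive_drop [recursive_intros]: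
  assumes "recursive k" "recursive l"
  shows "recursive (\<lambda>e. list_encode (drop (k e) (list_decode (l e))))"
proof -
  have "rec_nat c (\<lambda>_ r. psnd (r - Suc 0)) n = list_encode (drop n (list_decode c))" for c n
    by (induction n) (simp_all add: drop_Suc list_encode_tl flip: tl_drop)
  moreover have "recursive (\<lambda>e. rec_nat (l e) (\<lambda>_ r. psnd (r - Suc 0)) (k e))"
    by (intro recursive_intros assms)
  ultimately show ?thesis by simp
qed

text \<open>The recursion runs through the suffixes of the list; since a list is at most as long as its
  code, the code serves as the number of steps.\<close>

lemma recursive_rec_list:
  assumes a: "recursive a" and l: "recursive l"
    and g: "recursive (\<lambda>e. g (e 0) (e (Suc 0)) (e (Suc (Suc 0))) (\<lambda>i. e (Suc (Suc (Suc i)))))"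
  shows "recursive (\<lambda>e. rec_list (a e) (\<lambda>x xs r. g x (list_encode xs) r e) (list_decode (l e)))"
proof -
  define suffix where "suffix c k = list_encode (drop (c - Suc k) (list_decode c))" for c k
  define step where "step c e k r = (if suffix c k = 0 then r
    else g (pfst (suffix c k - Suc 0)) (psnd (suffix c k - Suc 0)) r e)" for c e k r
  have rec_nat_step: "rec_nat b (step c e) k =
      rec_list b (\<lambda>x xs r. g x (list_encode xs) r e) (drop (c - k) (list_decode c))"
    if "k \<le> c" for b c e k
    using that
  proof (induction k)
    case 0
    have "length (list_decode c) \<le> c"
      using length_le_list_encode[of "list_decode c"] by simp
    then show ?case by simp
  next
    case (Suc k)
    then have "c - k = Suc (c - Suc k)" by simp
    then have "drop (c - k) (list_decode c) = tl (drop (c - Suc k) (list_decode c))"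
      by (simp only: drop_Suc tl_drop)
    with Suc show ?case
      by (cases "drop (c - Suc k) (list_decode c)") (simp_all add: step_def suffix_def)
  qed
  have g_subst: "recursive (\<lambda>e. g (x e) (y e) (z e) (\<lambda>i. w i e))"
    if "recursive x" "recursive y" "recursive z" "\<And>i. recursive (w i)" for x y z w
    using recursive_subst[OF g, of "case_nat x (case_nat y (case_nat z w))"] that
    by (simp split: nat.split)
  have "recursive (\<lambda>e. rec_nat (a e) (step (l e) e) (l e))"
    unfolding step_def suffix_def
    by (intro recursive_intros decidable_eq_0 g_subst recursive_shift[OF recursive_shift[OF l]] a l)
  then show ?thesis by (simp add: rec_nat_step)
qed

lemma recursive_foldr [recursive_intros]:
  assumes g: "recursive (\<lambda>e. g (e 0) (e (Suc 0)) (\<lambda>i. e (Suc (Suc i))))"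
    and l: "recursive l" and a: "recursive a"
  shows "recursive (\<lambda>e. foldr (\<lambda>x r. g x r e) (list_decode (l e)) (a e))"
proof -
  have "rec_list b (\<lambda>x _ r. g x r e) xs = foldr (\<lambda>x r. g x r e) xs b" for b xs e
    by (induction xs) simp_all
  moreover have "recursive (\<lambda>e. g (e 0) (e (Suc (Suc 0))) (\<lambda>i. e (Suc (Suc (Suc i)))))"
    using recursive_subst[OF g, of "case_nat (\<lambda>e. e 0) (\<lambda>i e. e (Suc (Suc i)))"]
    by (simp add: recursive_var split: nat.split)
  ultimately show ?thesis
    using recursive_rec_list[of a l "\<lambda>x _. g x"] a l by simp
qed

lemma recursive_append [recursive_intros]:
  assumes "recursive f" "recursive g"
  shows "recursive (\<lambda>e. list_encode (list_decode (f e) @ list_decode (g e)))"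
proof -
  have "foldr (\<lambda>x r. Suc (prod_encode (x, r))) xs n = list_encode (xs @ list_decode n)" for xs n
    by (induction xs) simp_all
  moreover have "recursive (\<lambda>e. foldr (\<lambda>x r. Suc (prod_encode (x, r))) (list_decode (f e)) (g e))"
    by (intro recursive_intros assms)
  ultimately show ?thesis by simp
qed

lemma decidable_bex_list:
  assumes P: "decidable (\<lambda>e. P (e 0) (\<lambda>i. e (Suc i)))" and l: "recursive l"
  shows "decidable (\<lambda>e. \<exists>x\<in>set (list_decode (l e)). P x e)"
proof -
  have "foldr (\<lambda>x r. if Q x then 1 else r) xs 0 = (of_bool (\<exists>x\<in>set xs. Q x) :: nat)"
    for Q and xs :: "nat list"
    by (induction xs) (auto simp del: One_nat_def)
  moreover have "recursive (\<lambda>e. foldr (\<lambda>x r. if P x e then 1 else r) (list_decode (l e)) 0)"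
    by (intro recursive_intros decidable_subst1[OF P] l)
  ultimately show ?thesis by (simp add: decidable_def)
qed

lemma decidable_ball_list:
  assumes P: "decidable (\<lambda>e. P (e 0) (\<lambda>i. e (Suc i)))" and l: "recursive l"
  shows "decidable (\<lambda>e. \<forall>x\<in>set (list_decode (l e)). P x e)"
  using decidable_not[OF decidable_bex_list[OF decidable_not[OF P] l]] by simp

section \<open>Recursively enumerable predicates\<close>

definition enumerable :: "((nat \<Rightarrow> nat) \<Rightarrow> bool) \<Rightarrow> bool" where
  "enumerable P \<longleftrightarrow> (\<exists>D. decidable (\<lambda>e. D (e 0) (\<lambda>i. e (Suc i))) \<and> (\<forall>e. P e \<longleftrightarrow> (\<exists>w. D w e)))"

lemma enumerable_decidable:
  assumes "decidable P"
  shows "enumerable P"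
  unfolding enumerable_def
  using assms recursive_shift[of "\<lambda>e. of_bool (P e)"]
  by (intro exI[of _ "\<lambda>_. P"]) (simp add: decidable_def)

named_theorems enumerable_intros

lemma enumerable_eq [enumerable_intros]: "recursive f \<Longrightarrow> recursive g \<Longrightarrow> enumerable (\<lambda>e. f e = g e)"
  by (intro enumerable_decidable decidable_eq)

lemma enumerable_subst1:
  assumes P: "enumerable (\<lambda>e. P (e 0) (\<lambda>i. e (Suc i)))"
    and f: "recursive f" and g: "\<And>i. recursive (g i)"
  shows "enumerable (\<lambda>e. P (f e) (\<lambda>i. g i e))"
proof -
  obtain D where D: "decidable (\<lambda>e. D (e 0) (\<lambda>i. e (Suc i)))"
    and P_iff: "\<forall>e. P (e 0) (\<lambda>i. e (Suc i)) \<longleftrightarrow> (\<exists>w. D w e)"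
    using P unfolding enumerable_def by blast
  have "P (f e) (\<lambda>i. g i e) \<longleftrightarrow> (\<exists>w. D w (case_nat (f e) (\<lambda>i. g i e)))" for e
    using P_iff[rule_format, of "case_nat (f e) (\<lambda>i. g i e)"] by simp
  moreover have "decidable (\<lambda>e. D (e 0) (case_nat (f (\<lambda>i. e (Suc i))) (\<lambda>i. g i (\<lambda>i. e (Suc i)))))"
    by (intro decidable_subst1[OF D] recursive_intros recursive_shift f g)
  ultimately show ?thesis
    unfolding enumerable_def by (intro exI[of _ "\<lambda>w e. D w (case_nat (f e) (\<lambda>i. g i e))"]) simp
qed

lemma enumerable_ex [enumerable_intros]:
  assumes "enumerable (\<lambda>e. P (e 0) (\<lambda>i. e (Suc i)))"
  shows "enumerable (\<lambda>e. \<exists>x. P x e)"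
proof -
  obtain D where D: "decidable (\<lambda>e. D (e 0) (\<lambda>i. e (Suc i)))"
    and P_iff: "\<forall>e. P (e 0) (\<lambda>i. e (Suc i)) \<longleftrightarrow> (\<exists>w. D w e)"
    using assms unfolding enumerable_def by blast
  have "(\<exists>x. P x e) \<longleftrightarrow> (\<exists>n. D (psnd n) (case_nat (pfst n) e))" for e
  proof -
    have "(\<exists>x. P x e) \<longleftrightarrow> (\<exists>x w. D w (case_nat x e))"
      using P_iff[rule_format, of "case_nat x e" for x] by simp
    also have "\<dots> \<longleftrightarrow> (\<exists>n. D (psnd n) (case_nat (pfst n) e))"
      by (metis fst_conv snd_conv prod_encode_inverse)
    finally show ?thesis .
  qed
  moreover have "decidable (\<lambda>e. D (psnd (e 0)) (case_nat (pfst (e 0)) (\<lambda>i. e (Suc i))))"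
    by (intro decidable_subst1[OF D] recursive_intros)
  ultimately show ?thesis
    unfolding enumerable_def by (intro exI[of _ "\<lambda>n e. D (psnd n) (case_nat (pfst n) e)"]) simp
qed

lemma enumerable_conj [enumerable_intros]:
  assumes "enumerable P" "enumerable Q"
  shows "enumerable (\<lambda>e. P e \<and> Q e)"
proof -
  obtain D E where D: "decidable (\<lambda>e. D (e 0) (\<lambda>i. e (Suc i)))" "\<forall>e. P e \<longleftrightarrow> (\<exists>w. D w e)"
    and E: "decidable (\<lambda>e. E (e 0) (\<lambda>i. e (Suc i)))" "\<forall>e. Q e \<longleftrightarrow> (\<exists>w. E w e)"
    using assms unfolding enumerable_def by blast
  have "enumerable (\<lambda>e. \<exists>v w. D v e \<and> E w e)"
    by (intro enumerable_ex enumerable_decidable decidable_conj decidable_subst1[OF D(1)]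
        decidable_subst1[OF E(1)] recursive_var)
  then show ?thesis by (simp add: D(2) E(2))
qed

lemma enumerable_disj [enumerable_intros]:
  assumes "enumerable P" "enumerable Q"
  shows "enumerable (\<lambda>e. P e \<or> Q e)"
proof -
  obtain D E where D: "decidable (\<lambda>e. D (e 0) (\<lambda>i. e (Suc i)))" "\<forall>e. P e \<longleftrightarrow> (\<exists>w. D w e)"
    and E: "decidable (\<lambda>e. E (e 0) (\<lambda>i. e (Suc i)))" "\<forall>e. Q e \<longleftrightarrow> (\<exists>w. E w e)"
    using assms unfolding enumerable_def by blast
  have "enumerable (\<lambda>e. \<exists>v w. D v e \<or> E w e)"
    by (intro enumerable_ex enumerable_decidable decidable_disj decidable_subst1[OF D(1)]
        decidable_subst1[OF E(1)] recursive_var)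
  then show ?thesis by (simp add: D(2) E(2))
qed

text \<open>Finitely many witnesses have a common bound, so the quantifier over the list passes inside
  the search for a witness.\<close>

lemma enumerable_ball_list:
  assumes P: "enumerable (\<lambda>e. P (e 0) (\<lambda>i. e (Suc i)))" and l: "recursive l"
  shows "enumerable (\<lambda>e. \<forall>x\<in>set (list_decode (l e)). P x e)"
proof -
  obtain D where D: "decidable (\<lambda>e. D (e 0) (\<lambda>i. e (Suc i)))"
    and P_iff: "\<forall>e. P (e 0) (\<lambda>i. e (Suc i)) \<longleftrightarrow> (\<exists>w. D w e)"
    using P unfolding enumerable_def by blast
  have P_iff_witness: "P x e \<longleftrightarrow> (\<exists>w. D w (case_nat x e))" for x e
    using P_iff[rule_format, of "case_nat x e"] by simp
  have "(\<forall>x\<in>set xs. P x e) \<longleftrightarrow> (\<exists>b. \<forall>x\<in>set xs. \<exists>w<b. D w (case_nat x e))" for xs e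
  proof
    assume "\<forall>x\<in>set xs. P x e"
    then obtain w where "\<forall>x\<in>set xs. D (w x) (case_nat x e)" unfolding P_iff_witness by metis
    moreover obtain b where "\<forall>x\<in>set xs. w x < b"
      using finite_nat_set_iff_bounded[of "w ` set xs"] by auto
    ultimately show "\<exists>b. \<forall>x\<in>set xs. \<exists>w<b. D w (case_nat x e)" by blast
  qed (auto simp: P_iff_witness)
  moreover have "enumerable (\<lambda>e. \<exists>b. \<forall>x\<in>set (list_decode (l e)). \<exists>w<b. D w (case_nat x e))"
    by (intro enumerable_ex enumerable_decidable decidable_ball_list decidable_bex_less
        decidable_subst1[OF D] recursive_shift[OF l] recursive_intros)
  ultimately show ?thesis by simp
qed

lemma recursive_binaryE:
  assumes "recursive (\<lambda>e. F (e 0) (e (Suc 0)))"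
  obtains r where "\<And>m n. eval r [m, n] (F m n)"
proof -
  from assms obtain r k where r: "\<forall>e. \<forall>m\<ge>k. eval r (map e [0..<m]) (F (e 0) (e (Suc 0)))"
    unfolding recursive_def by blast
  let ?s = "Comp r (Proj 0 # Proj 1 # replicate k Zero)"
  have "eval ?s [m, n] (F m n)" for m n
  proof (rule eval_Comp)
    show "eval r (m # n # replicate k 0) (F m n)"
      using r[rule_format, of "Suc (Suc k)" "case_nat m (case_nat n (\<lambda>_. 0))"]
      by (simp add: map_upt_Suc_shift map_replicate_trivial del: upt_Suc)
    show "list_all2 (\<lambda>g y. eval g [m, n] y) (Proj 0 # Proj 1 # replicate k Zero)
        (m # n # replicate k 0)"
      using eval_Proj[of 0 "[m, n]"] eval_Proj[of 1 "[m, n]"]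
      by (simp add: list_all2_conv_all_nth All_less_Suc2 eval_Zero)
  qed
  then show thesis by (rule that)
qed

lemma enumerable_imp_re_set:
  assumes "enumerable (\<lambda>e. e 0 \<in> S)"
  shows "re_set S"
proof -
  obtain D where D: "decidable (\<lambda>e. D (e 0) (\<lambda>i. e (Suc i)))"
    and S: "\<forall>e. e 0 \<in> S \<longleftrightarrow> (\<exists>w. D w e)"
    using assms unfolding enumerable_def by blast
  have "decidable (\<lambda>e. \<not> D (e 0) (\<lambda>i. e (Suc 0)))"
    by (intro decidable_not decidable_subst1[OF D] recursive_var)
  then obtain r where r: "\<And>w x. eval r [w, x] (of_bool (\<not> D w (\<lambda>_. x)))"
    unfolding decidable_def by (rule recursive_binaryE) (rule that)
  have "x \<in> S \<longleftrightarrow> (\<exists>y. eval (Mn r) [x] y)" for x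
    using S[rule_format, of "\<lambda>_. x"] exists_least_iff[of "\<lambda>w. D w (\<lambda>_. x)"]
    by (simp add: eval_Mn_iff[OF r])
  then show ?thesis unfolding re_set_def by blast
qed

section \<open>Sets generated by finitary rules\<close>

inductive generated :: "('a \<Rightarrow> 'a list \<Rightarrow> bool) \<Rightarrow> 'a \<Rightarrow> bool" for Rule where
  generated_rule: "Rule a bs \<Longrightarrow> \<forall>b\<in>set bs. generated Rule b \<Longrightarrow> generated Rule a"

text \<open>A line of a derivation codes \<open>(c, ps, w)\<close>: the conclusion, the list of premises, and a witness
  for the recursively enumerable side condition. Lines are justified by later lines.\<close>

primrec derivation :: "(nat \<Rightarrow> nat \<Rightarrow> nat list \<Rightarrow> bool) \<Rightarrow> nat list \<Rightarrow> bool" where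
  "derivation R [] \<longleftrightarrow> True"
| "derivation R (l # ls) \<longleftrightarrow>
     R (psnd (psnd l)) (pfst l) (list_decode (pfst (psnd l))) \<and>
     (\<forall>p\<in>set (list_decode (pfst (psnd l))). \<exists>k\<in>set ls. pfst k = p) \<and> derivation R ls"

lemma derivation_append: "derivation R ks \<Longrightarrow> derivation R ls \<Longrightarrow> derivation R (ks @ ls)"
  by (induction ks) auto

lemma derivation_of_list:
  assumes "\<forall>p\<in>set ps. \<exists>ls. derivation R ls \<and> p \<in> pfst ` set ls"
  shows "\<exists>ls. derivation R ls \<and> set ps \<subseteq> pfst ` set ls"
  using assms
proof (induction ps)
  case Nil
  show ?case by (intro exI[of _ "[]"]) simp
next
  case (Cons p ps)
  then obtain ks ls where "derivation R ks" "p \<in> pfst ` set ks"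
    and "derivation R ls" "set ps \<subseteq> pfst ` set ls" by auto
  then show ?case by (intro exI[of _ "ks @ ls"]) (auto simp: derivation_append)
qed

lemma generated_iff_derivation:
  "generated (\<lambda>c ps. \<exists>w. R w c ps) c \<longleftrightarrow> (\<exists>ls. derivation R ls \<and> c \<in> pfst ` set ls)"
  (is "?G c \<longleftrightarrow> _")
proof
  assume "?G c"
  then show "\<exists>ls. derivation R ls \<and> c \<in> pfst ` set ls"
  proof (induction rule: generated.induct)
    case (generated_rule c ps)
    from generated_rule(2) have "\<forall>p\<in>set ps. \<exists>ls. derivation R ls \<and> p \<in> pfst ` set ls" by blast
    then obtain ls where ls: "derivation R ls" "set ps \<subseteq> pfst ` set ls"
      using derivation_of_list by blast
    from generated_rule(1) obtain w where "R w c ps" by blast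
    with ls have "derivation R (prod_encode (c, prod_encode (list_encode ps, w)) # ls)" by auto
    then show ?case by fastforce
  qed
next
  have "derivation R ls \<Longrightarrow> \<forall>l\<in>set ls. ?G (pfst l)" for ls
  proof (induction ls)
    case (Cons l ls)
    then have "\<forall>p\<in>set (list_decode (pfst (psnd l))). ?G p" by fastforce
    with Cons have "?G (pfst l)"
      by (intro generated_rule[where bs = "list_decode (pfst (psnd l))"]) auto
    with Cons show ?case by simp
  qed simp
  then show "\<exists>ls. derivation R ls \<and> c \<in> pfst ` set ls \<Longrightarrow> ?G c" by blast
qed

lemma decidable_derivation:
  assumes R: "decidable (\<lambda>e. R (e 0) (e (Suc 0)) (list_decode (e (Suc (Suc 0)))))"
    and l: "recursive l"
  shows "decidable (\<lambda>e. derivation R (list_decode (l e)))"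
proof -
  define valid where "valid x n \<longleftrightarrow> R (psnd (psnd x)) (pfst x) (list_decode (pfst (psnd x))) \<and>
     (\<forall>p\<in>set (list_decode (pfst (psnd x))). \<exists>k\<in>set (list_decode n). pfst k = p)" for x n
  let ?step = "\<lambda>x n r. if valid x n then r else 0 :: nat"
  have R_subst: "decidable (\<lambda>e. R (f e) (g e) (list_decode (h e)))"
    if "recursive f" "recursive g" "recursive h" for f g h
    using decidable_subst1[of "\<lambda>w e. R w (e 0) (list_decode (e (Suc 0)))" f "case_nat g (\<lambda>_. h)"]
      R that by (simp split: nat.split)
  have "recursive (\<lambda>e. ?step (e 0) (e (Suc 0)) (e (Suc (Suc 0))))"
    unfolding valid_def by (intro recursive_intros R_subst decidable_ball_list decidable_bex_list)
  then have "recursive (\<lambda>e. rec_list 1 (\<lambda>x xs r. ?step x (list_encode xs) r) (list_decode (l e)))"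
    using recursive_rec_list[of "\<lambda>_. 1" l "\<lambda>x n r _. ?step x n r"] l by (simp add: recursive_const)
  moreover have "rec_list 1 (\<lambda>x xs r. ?step x (list_encode xs) r) ls = of_bool (derivation R ls)"
    for ls by (induction ls) (auto simp: valid_def)
  ultimately show ?thesis by (simp add: decidable_def)
qed

lemma enumerable_generated_nat:
  assumes "enumerable (\<lambda>e. Rule (e 0) (list_decode (e (Suc 0))))"
  shows "enumerable (\<lambda>e. generated Rule (e 0))"
proof -
  obtain D where D: "decidable (\<lambda>e. D (e 0) (\<lambda>i. e (Suc i)))"
    and D_iff: "\<forall>e. Rule (e 0) (list_decode (e (Suc 0))) \<longleftrightarrow> (\<exists>w. D w e)"
    using assms unfolding enumerable_def by blast
  define R where "R w c ps \<longleftrightarrow> D w (case_nat c (\<lambda>_. list_encode ps))" for w c ps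
  have Rule_eq: "Rule = (\<lambda>c ps. \<exists>w. R w c ps)"
    using D_iff[rule_format, of "case_nat c (\<lambda>_. list_encode ps)" for c ps]
    by (simp add: R_def fun_eq_iff)
  have "decidable (\<lambda>e. D (e 0) (case_nat (e (Suc 0)) (\<lambda>_. e (Suc (Suc 0)))))"
    by (intro decidable_subst1[OF D] recursive_intros)
  then have R: "decidable (\<lambda>e. R (e 0) (e (Suc 0)) (list_decode (e (Suc (Suc 0)))))"
    by (simp add: R_def)
  have "generated Rule c \<longleftrightarrow>
      (\<exists>n. derivation R (list_decode n) \<and> (\<exists>l\<in>set (list_decode n). pfst l = c))" for c
    unfolding Rule_eq generated_iff_derivation by (metis image_iff list_encode_inverse)
  moreover have "enumerable (\<lambda>e. \<exists>n. derivation R (list_decode n) \<and>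
      (\<exists>l\<in>set (list_decode n). pfst l = e 0))"
    by (intro enumerable_ex enumerable_decidable decidable_conj decidable_derivation[OF R]
        decidable_bex_list recursive_intros)
  ultimately show ?thesis by simp
qed

lemma eq_list_encode_iff: "n = list_encode xs \<longleftrightarrow> list_decode n = xs"
  by (metis list_decode_inverse list_encode_inverse)

abbreviation list_code :: "('a \<Rightarrow> nat) \<Rightarrow> 'a list \<Rightarrow> nat" where
  "list_code c xs \<equiv> list_encode (map c xs)"

definition coded_rule :: "('a \<Rightarrow> nat) \<Rightarrow> ('a \<Rightarrow> 'a list \<Rightarrow> bool) \<Rightarrow> nat \<Rightarrow> nat \<Rightarrow> bool" where
  "coded_rule c Rule m n \<longleftrightarrow> (\<exists>a bs. m = c a \<and> n = list_code c bs \<and> Rule a bs)"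

lemma coded_rule_simps:
  "coded_rule c (\<lambda>a bs. R a bs \<or> S a bs) m n \<longleftrightarrow> coded_rule c R m n \<or> coded_rule c S m n"
  "coded_rule c (\<lambda>a bs. \<exists>x. Q x a bs) m n \<longleftrightarrow> (\<exists>x. coded_rule c (Q x) m n)"
  "coded_rule c (\<lambda>a bs. a = t \<and> bs = ts) m n \<longleftrightarrow> m = c t \<and> n = list_code c ts"
  "coded_rule c (\<lambda>a bs. a = t \<and> bs = ts \<and> P) m n \<longleftrightarrow> m = c t \<and> n = list_code c ts \<and> P"
  unfolding coded_rule_def by blast+

theorem enumerable_generated:
  assumes inj: "inj c" and Rule: "enumerable (\<lambda>e. coded_rule c Rule (e 0) (e (Suc 0)))"
  shows "enumerable (\<lambda>e. e 0 \<in> c ` {a. generated Rule a})"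
proof -
  let ?Rule = "\<lambda>m ns. coded_rule c Rule m (list_encode ns)"
  have "enumerable (\<lambda>e. generated ?Rule (e 0))"
    using Rule by (intro enumerable_generated_nat) simp
  moreover have "generated ?Rule m \<longleftrightarrow> m \<in> c ` {a. generated Rule a}" for m
  proof
    show "generated ?Rule m \<Longrightarrow> m \<in> c ` {a. generated Rule a}"
    proof (induction rule: generated.induct)
      case (generated_rule m ns)
      then obtain a bs where "m = c a" "Rule a bs" "\<forall>b\<in>set bs. c b \<in> c ` {a. generated Rule a}"
        by (auto simp: coded_rule_def list_encode_eq)
      then show ?case by (auto simp: inj_image_mem_iff[OF inj] intro: generated.intros)
    qed
    have "generated Rule a \<Longrightarrow> generated ?Rule (c a)" for a
    proof (induction rule: generated.induct)
      case (generated_rule a bs)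
      then have "?Rule (c a) (map c bs)" unfolding coded_rule_def by blast
      then show ?case by (rule generated.intros) (use generated_rule(2) in simp)
    qed
    then show "m \<in> c ` {a. generated Rule a} \<Longrightarrow> generated ?Rule m" by auto
  qed
  ultimately show ?thesis by simp
qed

section \<open>Effective codings\<close>

definition effective :: "('a \<Rightarrow> nat) \<Rightarrow> bool" where
  "effective c \<longleftrightarrow> inj c \<and> enumerable (\<lambda>e. e 0 \<in> range c)"

lemma enumerable_ex_code:
  assumes "effective c" "enumerable (\<lambda>e. P (e 0) (\<lambda>i. e (Suc i)))"
  shows "enumerable (\<lambda>e. \<exists>a. P (c a) e)"
proof -
  have "enumerable (\<lambda>e. \<exists>n. n \<in> range c \<and> P n e)"
    using assms unfolding effective_def by (intro enumerable_ex enumerable_conj) simp_all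
  moreover have "(\<exists>n. n \<in> range c \<and> P n e) \<longleftrightarrow> (\<exists>a. P (c a) e)" for e by blast
  ultimately show ?thesis by simp
qed

lemma effective_id: "effective (\<lambda>n. n)"
  by (simp add: effective_def enumerable_decidable decidable_const)

lemma effective_list:
  assumes "effective c"
  shows "effective (list_code c)"
proof -
  have "inj (list_code c)"
    using assms by (auto simp: effective_def inj_on_def list_encode_eq)
  moreover have "n \<in> range (list_code c) \<longleftrightarrow> (\<forall>m\<in>set (list_decode n). m \<in> range c)" for n
  proof -
    have "n \<in> range (list_code c) \<longleftrightarrow> (\<exists>xs. list_decode n = map c xs)"
      by (auto simp: eq_list_encode_iff)
    then show ?thesis by (auto simp: ex_map_conv)
  qed
  moreover have "enumerable (\<lambda>e. \<forall>m\<in>set (list_decode (e 0)). m \<in> range c)"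
    using assms by (intro enumerable_ball_list recursive_var) (simp add: effective_def)
  ultimately show ?thesis by (simp add: effective_def)
qed

lemma effective_list_encode: "effective list_encode"
  using effective_list[OF effective_id] by simp

section \<open>A universal recursively enumerable set\<close>

fun recf_code :: "recf \<Rightarrow> nat" where
  "recf_code Zero = prod_encode (0, 0)"
| "recf_code Succ = prod_encode (1, 0)"
| "recf_code (Proj i) = prod_encode (2, i)"
| "recf_code (Comp f gs) = prod_encode (3, prod_encode (recf_code f, list_code recf_code gs))"
| "recf_code (Prec f g) = prod_encode (4, prod_encode (recf_code f, recf_code g))"
| "recf_code (Mn f) = prod_encode (5, recf_code f)"

lemma inj_recf_code: "inj recf_code"
proof (rule injI)
  fix f g assume "recf_code f = recf_code g"
  then show "f = g"
  proof (induction f arbitrary: g)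
    case Zero
    then show ?case by (cases g) (simp_all add: prod_encode_eq)
  next
    case Succ
    then show ?case by (cases g) (simp_all add: prod_encode_eq)
  next
    case (Proj i)
    then show ?case by (cases g) (simp_all add: prod_encode_eq)
  next
    case (Comp f fs)
    then obtain f' gs where g: "g = Comp f' gs" "recf_code f = recf_code f'"
      and map_eq: "map recf_code fs = map recf_code gs"
      by (cases g) (auto simp: prod_encode_eq list_encode_eq)
    have "fs = gs"
      using map_eq by (rule list.inj_map_strong[rotated]) (rule Comp.IH(2))
    with Comp.IH(1) g show ?case by simp
  next
    case (Prec f h)
    then show ?case by (cases g) (simp_all add: prod_encode_eq)
  next
    case (Mn f)
    then show ?case by (cases g) (simp_all add: prod_encode_eq)
  qed
qed

inductive recf_code_rule :: "nat \<Rightarrow> nat list \<Rightarrow> bool" where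
  "recf_code_rule (prod_encode (0, 0)) []"
| "recf_code_rule (prod_encode (1, 0)) []"
| "recf_code_rule (prod_encode (2, i)) []"
| "recf_code_rule (prod_encode (3, prod_encode (f, list_encode gs))) (f # gs)"
| "recf_code_rule (prod_encode (4, prod_encode (f, g))) [f, g]"
| "recf_code_rule (prod_encode (5, f)) [f]"

lemma generated_recf_code_rule: "generated recf_code_rule n \<longleftrightarrow> n \<in> range recf_code"
proof
  assume "generated recf_code_rule n"
  then show "n \<in> range recf_code"
  proof (induction rule: generated.induct)
    case (generated_rule n ps)
    then have "\<forall>p\<in>set ps. \<exists>f. p = recf_code f" by blast
    then obtain fs where "ps = map recf_code fs" by (auto simp flip: ex_map_conv)
    with generated_rule(1) show ?case
      by cases (auto simp flip: recf_code.simps One_nat_def)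
  qed
next
  have "generated recf_code_rule (recf_code f)" for f
    by (induction f; unfold recf_code.simps)
      (rule generated_rule[of recf_code_rule], rule recf_code_rule.intros, simp)+
  then show "n \<in> range recf_code \<Longrightarrow> generated recf_code_rule n" by auto
qed

lemma effective_recf_code: "effective recf_code"
proof -
  have "enumerable (\<lambda>e. recf_code_rule (e 0) (list_decode (e (Suc 0))))"
    unfolding recf_code_rule.simps eq_list_encode_iff[symmetric]
    by (simp, intro enumerable_disj)
      (intro enumerable_intros enumerable_ex_code[OF effective_list_encode] recursive_intros)+
  then show ?thesis
    using enumerable_generated_nat[of recf_code_rule] inj_recf_code
    by (simp add: effective_def generated_recf_code_rule)
qed

text \<open>The two auxiliary judgements spread the premises of composition and minimization over several
  rules, so that every rule has a fixed number of premises.\<close>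

datatype judgement =
    Value recf "nat list" nat
  | Values "recf list" "nat list" "nat list"
  | Positive_below nat recf "nat list"

primrec judgement_code :: "judgement \<Rightarrow> nat" where
  "judgement_code (Value f xs y) =
     prod_encode (0, prod_encode (recf_code f, prod_encode (list_encode xs, y)))"
| "judgement_code (Values gs xs ys) =
     prod_encode (1, prod_encode (list_code recf_code gs,
       prod_encode (list_encode xs, list_encode ys)))"
| "judgement_code (Positive_below n f xs) =
     prod_encode (2, prod_encode (n, prod_encode (recf_code f, list_encode xs)))"

primrec judgement_holds :: "judgement \<Rightarrow> bool" where
  "judgement_holds (Value f xs y) \<longleftrightarrow> eval f xs y"
| "judgement_holds (Values gs xs ys) \<longleftrightarrow> list_all2 (\<lambda>g y. eval g xs y) gs ys"
| "judgement_holds (Positive_below n f xs) \<longleftrightarrow> (\<forall>m<n. \<exists>y. eval f (m # xs) (Suc y))"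

inductive eval_rule :: "judgement \<Rightarrow> judgement list \<Rightarrow> bool" where
  eval_rule_Zero: "eval_rule (Value Zero xs 0) []"
| eval_rule_Succ: "eval_rule (Value Succ (x # xs) (Suc x)) []"
| eval_rule_Proj_0: "eval_rule (Value (Proj 0) (x # xs) x) []"
| eval_rule_Proj_Suc: "eval_rule (Value (Proj (Suc i)) (x # xs) y) [Value (Proj i) xs y]"
| eval_rule_Comp: "eval_rule (Value (Comp f gs) xs y) [Values gs xs ys, Value f ys y]"
| eval_rule_Prec_0: "eval_rule (Value (Prec f g) (0 # xs) y) [Value f xs y]"
| eval_rule_Prec_Suc: "eval_rule (Value (Prec f g) (Suc n # xs) y)
    [Value (Prec f g) (n # xs) r, Value g (n # r # xs) y]"
| eval_rule_Mn: "eval_rule (Value (Mn f) xs n) [Value f (n # xs) 0, Positive_below n f xs]"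
| eval_rule_Nil: "eval_rule (Values [] xs []) []"
| eval_rule_Cons: "eval_rule (Values (g # gs) xs (y # ys)) [Value g xs y, Values gs xs ys]"
| eval_rule_Positive_0: "eval_rule (Positive_below 0 f xs) []"
| eval_rule_Positive_Suc: "eval_rule (Positive_below (Suc n) f xs)
    [Positive_below n f xs, Value f (n # xs) (Suc y)]"

lemma eval_Proj_iff: "eval (Proj i) xs y \<longleftrightarrow> i < length xs \<and> y = xs ! i"
  by (auto intro: eval_Proj elim: eval.cases)

lemma eval_rule_sound: "eval_rule j js \<Longrightarrow> \<forall>j\<in>set js. judgement_holds j \<Longrightarrow> judgement_holds j"
  by (induction rule: eval_rule.induct)
    (auto simp: eval_Proj_iff less_Suc_eq intro: eval.intros)

lemma generated_Values:
  assumes "list_all2 (\<lambda>g y. generated eval_rule (Value g xs y)) gs ys"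
  shows "generated eval_rule (Values gs xs ys)"
  using assms
proof (induction rule: list_all2_induct)
  case Nil
  show ?case by (rule generated_rule, rule eval_rule_Nil) simp
next
  case (Cons g gs y ys)
  then show ?case by (intro generated_rule[of eval_rule, OF eval_rule_Cons]) simp
qed

lemma generated_Positive_below:
  assumes "\<forall>m<n. \<exists>y. generated eval_rule (Value f (m # xs) (Suc y))"
  shows "generated eval_rule (Positive_below n f xs)"
  using assms
proof (induction n)
  case 0
  show ?case by (rule generated_rule, rule eval_rule_Positive_0) simp
next
  case (Suc n)
  then obtain y where "generated eval_rule (Value f (n # xs) (Suc y))" by blast
  with Suc show ?case by (intro generated_rule[of eval_rule, OF eval_rule_Positive_Suc]) simp
qed

lemma generated_Proj: "i < length xs \<Longrightarrow> generated eval_rule (Value (Proj i) xs (xs ! i))"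
proof (induction i arbitrary: xs)
  case 0
  then show ?case by (cases xs) (simp_all add: generated_rule[of eval_rule, OF eval_rule_Proj_0])
next
  case (Suc i)
  then show ?case by (cases xs) (simp_all add: generated_rule[of eval_rule, OF eval_rule_Proj_Suc])
qed

lemma generated_Value: "eval f xs y \<Longrightarrow> generated eval_rule (Value f xs y)"
proof (induction rule: eval.induct)
  case (eval_Zero xs)
  show ?case by (rule generated_rule, rule eval_rule_Zero) simp
next
  case (eval_Succ x xs)
  show ?case by (rule generated_rule, rule eval_rule_Succ) simp
next
  case (eval_Proj i xs)
  then show ?case by (rule generated_Proj)
next
  case (eval_Comp xs gs ys f y)
  from eval_Comp.IH(1) have "generated eval_rule (Values gs xs ys)"
    by (intro generated_Values) (auto elim: list_all2_mono)
  with eval_Comp.IH(2) show ?case by (intro generated_rule[of eval_rule, OF eval_rule_Comp]) simp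
next
  case (eval_Prec0 f xs y g)
  then show ?case by (intro generated_rule[of eval_rule, OF eval_rule_Prec_0]) simp
next
  case (eval_PrecS f g n xs r y)
  then show ?case by (intro generated_rule[of eval_rule, OF eval_rule_Prec_Suc]) simp
next
  case (eval_Mn f n xs)
  from eval_Mn.IH(2) have "generated eval_rule (Positive_below n f xs)"
    by (intro generated_Positive_below) blast
  with eval_Mn.IH(1) show ?case by (intro generated_rule[of eval_rule, OF eval_rule_Mn]) simp
qed

lemma generated_eval_rule_iff: "generated eval_rule (Value f xs y) \<longleftrightarrow> eval f xs y"
proof
  have "generated eval_rule j \<Longrightarrow> judgement_holds j" for j
    by (induction rule: generated.induct) (auto intro: eval_rule_sound)
  then show "generated eval_rule (Value f xs y) \<Longrightarrow> eval f xs y" by fastforce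
qed (rule generated_Value)

lemma inj_judgement_code: "inj judgement_code"
proof (rule injI)
  fix j k assume "judgement_code j = judgement_code k"
  then show "j = k"
    by (cases j; cases k)
      (auto simp: prod_encode_eq list_encode_eq inj_eq[OF inj_recf_code]
        inj_map_eq_map[OF inj_recf_code])
qed

lemma enumerable_eval_rule:
  "enumerable (\<lambda>e. coded_rule judgement_code eval_rule (e 0) (e (Suc 0)))"
  unfolding eval_rule.simps[abs_def] coded_rule_simps
  by (simp, intro enumerable_disj)
    (intro enumerable_intros enumerable_ex_code[OF effective_list_encode]
      enumerable_ex_code[OF effective_recf_code]
      enumerable_ex_code[OF effective_list[OF effective_recf_code]] recursive_intros)+

definition nth_re_set :: "nat \<Rightarrow> nat set" where
  "nth_re_set i = {n. \<exists>f y. i = recf_code f \<and> eval f [n] y}"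

lemma re_set_imp_nth_re_set:
  assumes "re_set S"
  obtains i where "S = nth_re_set i"
proof -
  obtain f where "S = {n. \<exists>y. eval f [n] y}" using assms unfolding re_set_def by blast
  then have "S = nth_re_set (recf_code f)"
    by (auto simp: nth_re_set_def inj_eq[OF inj_recf_code])
  then show thesis by (rule that)
qed

lemma enumerable_nth_re_set [enumerable_intros]:
  assumes "recursive f" "recursive g"
  shows "enumerable (\<lambda>e. g e \<in> nth_re_set (f e))"
proof -
  let ?E = "judgement_code ` {j. generated eval_rule j}"
  have "enumerable (\<lambda>e. e 0 \<in> ?E)"
    by (intro enumerable_generated inj_judgement_code enumerable_eval_rule)
  then have E: "enumerable (\<lambda>e. h e \<in> ?E)" if "recursive h" for h
    using enumerable_subst1[of "\<lambda>n _. n \<in> ?E" h "\<lambda>i e. e i"] that by (simp add: recursive_var)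
  have "n \<in> nth_re_set i \<longleftrightarrow> (\<exists>f y. i = recf_code f \<and>
      prod_encode (0, prod_encode (recf_code f, prod_encode (list_encode [n], y))) \<in> ?E)" for n i
    unfolding nth_re_set_def judgement_code.simps(1)[symmetric]
    by (simp only: inj_image_mem_iff[OF inj_judgement_code] mem_Collect_eq generated_eval_rule_iff)
  moreover have "enumerable (\<lambda>e. \<exists>h y. f e = recf_code h \<and>
      prod_encode (0, prod_encode (recf_code h, prod_encode (list_encode [g e], y))) \<in> ?E)"
    by simp (intro enumerable_intros enumerable_ex_code[OF effective_recf_code] E recursive_intros
      recursive_shift assms)
  ultimately show ?thesis by simp
qed

theorem re_set_iff_enumerable: "re_set S \<longleftrightarrow> enumerable (\<lambda>e. e 0 \<in> S)"
proof
  assume "re_set S"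
  then obtain i where "S = nth_re_set i" by (rule re_set_imp_nth_re_set)
  then show "enumerable (\<lambda>e. e 0 \<in> S)" by (simp add: enumerable_nth_re_set recursive_intros)
qed (rule enumerable_imp_re_set)

section \<open>Presented groups\<close>

lemma words_Nil [simp]: "[] \<in> words Xs"
  by (simp add: words_def)

lemma words_Cons [simp]: "(x, b) # w \<in> words Xs \<longleftrightarrow> x \<in> Xs \<and> w \<in> words Xs"
  by (auto simp: words_def)

lemma words_append [simp]: "u @ v \<in> words Xs \<longleftrightarrow> u \<in> words Xs \<and> v \<in> words Xs"
  by (auto simp: words_def)

lemma words_UNIV [simp]: "words UNIV = UNIV"
  by (simp add: words_def)

lemma peq_context: "peq Xs R u v \<Longrightarrow> peq Xs R (a @ u @ b) (a @ v @ b)"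
proof (induction rule: peq.induct)
  case (peq_cancel x u c v)
  then show ?case using peq.peq_cancel[of x Xs R "a @ u" c "v @ b"] by simp
next
  case (peq_rel r u v)
  then show ?case using peq.peq_rel[of r R Xs "a @ u" "v @ b"] by simp
next
  case (peq_trans u v w)
  then show ?case by (blast intro: peq.peq_trans)
qed (auto intro: peq.peq_refl peq.peq_sym)

lemma peq_append: "peq Xs R u u' \<Longrightarrow> peq Xs R v v' \<Longrightarrow> peq Xs R (u @ v) (u' @ v')"
  using peq_context[of Xs R u u' "[]" v] peq_context[of Xs R v v' u' "[]"]
  by (auto intro: peq_trans)

lemma peq_cancel_Cons: "x \<in> Xs \<Longrightarrow> peq Xs R (u @ (x, b) # (x, \<not> b) # v) (u @ v)"
  using peq_cancel[of x Xs R u b v] by simp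

lemma peq_relator: "r \<in> R \<Longrightarrow> peq Xs R r []"
  using peq_rel[of r R Xs "[]" "[]"] by simp

definition word_inv :: "word \<Rightarrow> word" where
  "word_inv w = rev (map (\<lambda>(x, b). (x, \<not> b)) w)"

lemma word_inv_words: "w \<in> words Xs \<Longrightarrow> word_inv w \<in> words Xs"
  by (auto simp: words_def word_inv_def)

lemma peq_word_inv: "w \<in> words Xs \<Longrightarrow> peq Xs R (word_inv w @ w) []"
proof (induction w)
  case Nil
  show ?case by (simp add: word_inv_def peq_refl)
next
  case (Cons l w)
  obtain x b where l: "l = (x, b)" by fastforce
  with Cons.prems have "x \<in> Xs" "w \<in> words Xs" by auto
  then have "peq Xs R (word_inv w @ [(x, \<not> b), (x, \<not> \<not> b)] @ w) (word_inv w @ w)"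
    by (intro peq_cancel)
  with Cons.IH[OF \<open>w \<in> words Xs\<close>] show ?case by (auto simp: l word_inv_def intro: peq_trans)
qed

abbreviation wclass :: "nat set \<Rightarrow> word set \<Rightarrow> word \<Rightarrow> word set" where
  "wclass Xs R w \<equiv> grel Xs R `` {w}"

lemma equiv_grel: "equiv (words Xs) (grel Xs R)"
  by (rule equivI)
    (auto simp: refl_on_def sym_def trans_def grel_def intro: peq_refl peq_sym peq_trans)

lemma wclass_eq_iff:
  "u \<in> words Xs \<Longrightarrow> v \<in> words Xs \<Longrightarrow> wclass Xs R u = wclass Xs R v \<longleftrightarrow> peq Xs R u v"
  by (subst eq_equiv_class_iff[OF equiv_grel]) (auto simp: grel_def)

lemma carrier_presented_group: "carrier (presented_group (Xs, R)) = wclass Xs R ` words Xs"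
  by (auto simp: presented_group_def quotient_def)

lemma wclass_in_carrier: "w \<in> words Xs \<Longrightarrow> wclass Xs R w \<in> carrier (presented_group (Xs, R))"
  unfolding carrier_presented_group by (rule imageI)

lemma one_presented_group: "\<one>\<^bsub>presented_group (Xs, R)\<^esub> = wclass Xs R []"
  by (simp add: presented_group_def)

lemma some_wclass:
  assumes "w \<in> words Xs"
  shows "(SOME x. x \<in> wclass Xs R w) \<in> words Xs" "peq Xs R w (SOME x. x \<in> wclass Xs R w)"
proof -
  have "w \<in> wclass Xs R w" using assms by (simp add: grel_def peq_refl)
  then have "(SOME x. x \<in> wclass Xs R w) \<in> wclass Xs R w" by (rule someI)
  then have "(w, SOME x. x \<in> wclass Xs R w) \<in> grel Xs R" by (simp only: Image_singleton_iff)
  then show "(SOME x. x \<in> wclass Xs R w) \<in> words Xs" "peq Xs R w (SOME x. x \<in> wclass Xs R w)"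
    unfolding grel_def by blast+
qed

lemma mult_presented_group:
  assumes "u \<in> words Xs" "v \<in> words Xs"
  shows "wclass Xs R u \<otimes>\<^bsub>presented_group (Xs, R)\<^esub> wclass Xs R v = wclass Xs R (u @ v)"
  using some_wclass[OF assms(1), of R] some_wclass[OF assms(2), of R] assms
  by (simp add: presented_group_def wclass_eq_iff peq_append peq_sym del: Image_singleton_iff)

lemma group_presented_group: "group (presented_group (Xs, R))"
proof (rule groupI)
  fix x assume "x \<in> carrier (presented_group (Xs, R))"
  then obtain w where w: "w \<in> words Xs" "x = wclass Xs R w" by (auto simp: carrier_presented_group)
  then have "wclass Xs R (word_inv w) \<otimes>\<^bsub>presented_group (Xs, R)\<^esub> x = \<one>\<^bsub>presented_group (Xs, R)\<^esub>"
    by (simp add: mult_presented_group one_presented_group word_inv_words wclass_eq_iff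
        peq_word_inv)
  with w(1) show "\<exists>y\<in>carrier (presented_group (Xs, R)).
      y \<otimes>\<^bsub>presented_group (Xs, R)\<^esub> x = \<one>\<^bsub>presented_group (Xs, R)\<^esub>"
    by (auto intro: wclass_in_carrier word_inv_words)
qed (auto simp: carrier_presented_group one_presented_group mult_presented_group)

lemma inv_wclass_generator:
  assumes "x \<in> Xs"
  shows "inv\<^bsub>presented_group (Xs, R)\<^esub> (wclass Xs R [(x, False)]) = wclass Xs R [(x, True)]"
proof (rule group.inv_equality[OF group_presented_group])
  show "wclass Xs R [(x, True)] \<otimes>\<^bsub>presented_group (Xs, R)\<^esub> wclass Xs R [(x, False)] =
      \<one>\<^bsub>presented_group (Xs, R)\<^esub>"
    using assms peq_word_inv[of "[(x, False)]" Xs R]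
    by (simp add: mult_presented_group one_presented_group wclass_eq_iff word_inv_def)
qed (simp_all add: assms wclass_in_carrier)

section \<open>Homomorphisms out of presented groups\<close>

fun word_value :: "('g, 'm) monoid_scheme \<Rightarrow> (nat \<Rightarrow> 'g) \<Rightarrow> word \<Rightarrow> 'g" where
  "word_value G \<phi> [] = \<one>\<^bsub>G\<^esub>"
| "word_value G \<phi> ((x, b) # w) = (if b then inv\<^bsub>G\<^esub> (\<phi> x) else \<phi> x) \<otimes>\<^bsub>G\<^esub> word_value G \<phi> w"

definition wpow :: "word \<Rightarrow> nat \<Rightarrow> word" where
  "wpow w n = concat (replicate n w)"

lemma wpow_simps [simp]: "wpow w 0 = []" "wpow w (Suc n) = w @ wpow w n"
  by (simp_all add: wpow_def)

lemma wpow_words: "w \<in> words Xs \<Longrightarrow> wpow w n \<in> words Xs"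
  by (induction n) simp_all

lemma (in group) word_value_closed [simp]:
  "(\<And>x. \<phi> x \<in> carrier G) \<Longrightarrow> word_value G \<phi> w \<in> carrier G"
  by (induction w) auto

lemma (in group) word_value_append:
  assumes \<phi>: "\<And>x. \<phi> x \<in> carrier G"
  shows "word_value G \<phi> (u @ v) = word_value G \<phi> u \<otimes> word_value G \<phi> v"
proof (induction u)
  case (Cons l u)
  then show ?case by (cases l) (simp add: m_assoc \<phi>)
qed (simp add: \<phi>)

lemma (in group) word_value_wpow:
  assumes \<phi>: "\<And>x. \<phi> x \<in> carrier G"
  shows "word_value G \<phi> (wpow w n) = word_value G \<phi> w [^] n"
  by (induction n) (simp_all add: word_value_append \<phi> flip: nat_pow_Suc2 del: nat_pow_Suc)

lemma (in group) word_value_one: "word_value G (\<lambda>_. \<one>) w = \<one>"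
  by (induction w) auto

lemma (in group) word_value_peq:
  assumes \<phi>: "\<And>x. \<phi> x \<in> carrier G" and R: "\<And>r. r \<in> R \<Longrightarrow> word_value G \<phi> r = \<one>"
    and "peq Xs R u v"
  shows "word_value G \<phi> u = word_value G \<phi> v"
  using assms(3)
proof (induction rule: peq.induct)
  case (peq_cancel x u b v)
  have "word_value G \<phi> [(x, b), (x, \<not> b)] = \<one>" by (cases b) (simp_all add: \<phi>)
  then show ?case by (simp only: word_value_append[OF \<phi>]) (simp add: \<phi>)
next
  case (peq_rel r u v)
  then show ?case by (simp add: word_value_append R \<phi>)
qed simp_all

theorem (in group) presented_group_universal:
  assumes \<phi>: "\<And>x. \<phi> x \<in> carrier G" and R: "\<And>r. r \<in> R \<Longrightarrow> word_value G \<phi> r = \<one>"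
  shows "\<exists>h\<in>hom (presented_group (Xs, R)) G. \<forall>w\<in>words Xs. h (wclass Xs R w) = word_value G \<phi> w"
proof -
  define h where "h c = word_value G \<phi> (SOME w. w \<in> c)" for c
  have h: "h (wclass Xs R w) = word_value G \<phi> w" if "w \<in> words Xs" for w
    unfolding h_def by (rule word_value_peq[OF \<phi> R peq_sym[OF some_wclass(2)[OF that]]])
  then have "h \<in> hom (presented_group (Xs, R)) G"
    by (intro homI) (auto simp: carrier_presented_group mult_presented_group word_value_append \<phi>)
  with h show ?thesis by blast
qed

definition generator_class :: "nat set \<Rightarrow> word set \<Rightarrow> nat \<Rightarrow> word set" where
  "generator_class Xs R x = (if x \<in> Xs then wclass Xs R [(x, False)] else wclass Xs R [])"

lemma generator_class_in_carrier: "generator_class Xs R x \<in> carrier (presented_group (Xs, R))"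
  by (simp add: generator_class_def wclass_in_carrier)

lemma word_value_generator_class:
  "w \<in> words Xs \<Longrightarrow> word_value (presented_group (Xs, R)) (generator_class Xs R) w = wclass Xs R w"
proof (induction w)
  case Nil
  show ?case by (simp add: one_presented_group)
next
  case (Cons l w)
  then show ?case
    by (cases l) (simp add: generator_class_def inv_wclass_generator mult_presented_group)
qed

section \<open>Torsion-free quotients\<close>

lemma wclass_pow:
  assumes "w \<in> words Xs"
  shows "wclass Xs R w [^]\<^bsub>presented_group (Xs, R)\<^esub> n = wclass Xs R (wpow w n)"
proof -
  interpret group "presented_group (Xs, R)" by (rule group_presented_group)
  show ?thesis
    using word_value_wpow[of "generator_class Xs R" w n] assms
    by (simp add: generator_class_in_carrier word_value_generator_class wpow_words)
qed

lemma (in group) int_pow_eq_one_iff: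
  "x \<in> carrier G \<Longrightarrow> x [^] (z::int) = \<one> \<longleftrightarrow> x [^] nat \<bar>z\<bar> = \<one>"
  by (auto simp: int_pow_def2 simp del: pow_nat)

lemma (in group) torsion_free_on_iff_nat_pow:
  "torsion_free_on A G \<longleftrightarrow> (\<forall>g\<in>carrier G. \<forall>z\<in>A. g [^] nat \<bar>z\<bar> = \<one> \<longrightarrow> g = \<one>)"
  unfolding torsion_free_on_def using int_pow_eq_one_iff by blast

inductive torsion_rule :: "int set \<Rightarrow> nat set \<Rightarrow> word set \<Rightarrow> word \<Rightarrow> word list \<Rightarrow> bool" for A Xs R where
  torsion_rule_relator: "r \<in> R \<Longrightarrow> torsion_rule A Xs R r []"
| torsion_rule_root: "w \<in> words Xs \<Longrightarrow> z \<in> A \<Longrightarrow>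
    peq Xs (set rs) (wpow w (nat \<bar>z\<bar>)) [] \<Longrightarrow> torsion_rule A Xs R w rs"

definition torsion_free_relators :: "int set \<Rightarrow> nat set \<Rightarrow> word set \<Rightarrow> word set" where
  "torsion_free_relators A Xs R = {w. generated (torsion_rule A Xs R) w}"

lemma relators_subset_torsion_free_relators: "R \<subseteq> torsion_free_relators A Xs R"
proof
  fix r assume "r \<in> R"
  then have "torsion_rule A Xs R r []" by (rule torsion_rule_relator)
  then have "generated (torsion_rule A Xs R) r" by (rule generated_rule) simp
  then show "r \<in> torsion_free_relators A Xs R" by (simp add: torsion_free_relators_def)
qed

lemma torsion_free_relators_subset_words:
  assumes "R \<subseteq> words Xs"
  shows "torsion_free_relators A Xs R \<subseteq> words Xs"
proof -
  have "w \<in> words Xs" if "generated (torsion_rule A Xs R) w" for w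
    using that
  proof cases
    case (generated_rule rs)
    from generated_rule(1) assms show ?thesis by cases auto
  qed
  then show ?thesis by (auto simp: torsion_free_relators_def)
qed

lemma peq_mono: "peq Xs R u v \<Longrightarrow> R \<subseteq> S \<Longrightarrow> peq Xs S u v"
  by (induction rule: peq.induct) (auto intro: peq_refl peq_sym peq_trans peq_cancel_Cons peq_rel)

lemma peq_finite: "peq Xs R u v \<Longrightarrow> \<exists>rs. set rs \<subseteq> R \<and> peq Xs (set rs) u v"
proof (induction rule: peq.induct)
  case (peq_trans u v w)
  then obtain rs ss where "set rs \<subseteq> R" "peq Xs (set rs) u v" "set ss \<subseteq> R" "peq Xs (set ss) v w"
    by blast
  then have "set (rs @ ss) \<subseteq> R" "peq Xs (set (rs @ ss)) u v" "peq Xs (set (rs @ ss)) v w"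
    by (auto elim: peq_mono)
  then show ?case by (blast intro: peq.peq_trans)
next
  case (peq_rel r u v)
  then show ?case by (intro exI[of _ "[r]"]) (simp add: peq.peq_rel)
qed (auto intro: exI[of _ "[]"] peq.peq_refl peq.peq_sym peq_cancel_Cons)

lemma torsion_free_relators_root:
  assumes w: "w \<in> words Xs" and z: "z \<in> A"
    and "peq Xs (torsion_free_relators A Xs R) (wpow w (nat \<bar>z\<bar>)) []"
  shows "w \<in> torsion_free_relators A Xs R"
proof -
  obtain rs where rs: "set rs \<subseteq> torsion_free_relators A Xs R"
    "peq Xs (set rs) (wpow w (nat \<bar>z\<bar>)) []" using peq_finite[OF assms(3)] by blast
  have "torsion_rule A Xs R w rs" by (rule torsion_rule_root[OF w z rs(2)])
  then have "generated (torsion_rule A Xs R) w"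
    by (rule generated_rule) (use rs(1) in \<open>auto simp: torsion_free_relators_def\<close>)
  then show ?thesis by (simp add: torsion_free_relators_def)
qed

theorem torsion_free_on_torsion_free_relators:
  "torsion_free_on A (presented_group (Xs, torsion_free_relators A Xs R))"
  (is "torsion_free_on A ?G")
proof -
  let ?N = "torsion_free_relators A Xs R"
  interpret group ?G by (rule group_presented_group)
  have "wclass Xs ?N w = \<one>\<^bsub>?G\<^esub>"
    if w: "w \<in> words Xs" and z: "z \<in> A"
      and pow: "wclass Xs ?N w [^]\<^bsub>?G\<^esub> nat \<bar>z\<bar> = \<one>\<^bsub>?G\<^esub>" for w z
  proof -
    from pow have "peq Xs ?N (wpow w (nat \<bar>z\<bar>)) []"
      by (simp add: w wclass_pow one_presented_group wclass_eq_iff wpow_words del: pow_nat)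
    with w z have "w \<in> ?N" by (rule torsion_free_relators_root)
    with w show ?thesis by (simp add: one_presented_group wclass_eq_iff peq_relator)
  qed
  then show ?thesis unfolding torsion_free_on_iff_nat_pow carrier_presented_group by blast
qed

theorem (in group) word_value_torsion_free_relators:
  assumes tf: "torsion_free_on A G" and \<phi>: "\<And>x. \<phi> x \<in> carrier G"
    and R: "\<And>r. r \<in> R \<Longrightarrow> word_value G \<phi> r = \<one>"
  shows "r \<in> torsion_free_relators A Xs R \<Longrightarrow> word_value G \<phi> r = \<one>"
  unfolding torsion_free_relators_def mem_Collect_eq
proof (induction rule: generated.induct)
  case (generated_rule w rs)
  from generated_rule(1) show ?case
  proof cases
    case torsion_rule_relator
    then show ?thesis by (intro R)
  next
    case (torsion_rule_root z)
    from torsion_rule_root(3) have "word_value G \<phi> (wpow w (nat \<bar>z\<bar>)) = word_value G \<phi> []"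
      using generated_rule(2) by (intro word_value_peq[OF \<phi>]) auto
    then have "word_value G \<phi> w [^] nat \<bar>z\<bar> = \<one>" by (simp add: word_value_wpow[OF \<phi>])
    with torsion_rule_root(2) tf word_value_closed[of \<phi>, OF \<phi>] show ?thesis
      unfolding torsion_free_on_iff_nat_pow by blast
  qed
qed

section \<open>Free products\<close>

definition tag_word :: "nat \<Rightarrow> word \<Rightarrow> word" where
  "tag_word i = map (\<lambda>(x, b). (prod_encode (i, x), b))"

text \<open>Every factor has all natural numbers as generators. The generators outside its own generating
  set are free; the retraction onto the factor kills them.\<close>

definition free_product_relators :: "(nat \<Rightarrow> word set) \<Rightarrow> word set" where
  "free_product_relators R = (\<Union>i. tag_word i ` R i)"

lemma word_value_tag_word:
  "word_value G \<phi> (tag_word i w) = word_value G (\<lambda>x. \<phi> (prod_encode (i, x))) w"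
  by (induction w) (auto simp: tag_word_def)

lemma free_product_inclusion:
  assumes N: "free_product_relators R \<subseteq> N"
  obtains h where "h \<in> hom (presented_group (Xs, R i)) (presented_group (UNIV, N))"
    "\<And>w. w \<in> words Xs \<Longrightarrow> h (wclass Xs (R i) w) = wclass UNIV N (tag_word i w)"
proof -
  let ?Q = "presented_group (UNIV, N)" and ?\<phi> = "\<lambda>x. generator_class UNIV N (prod_encode (i, x))"
  interpret Q: group ?Q by (rule group_presented_group)
  have \<phi>: "?\<phi> x \<in> carrier ?Q" for x by (rule generator_class_in_carrier)
  have value_\<phi>: "word_value ?Q ?\<phi> w = wclass UNIV N (tag_word i w)" for w
    unfolding word_value_tag_word[symmetric] by (simp add: word_value_generator_class)
  have "word_value ?Q ?\<phi> r = \<one>\<^bsub>?Q\<^esub>" if "r \<in> R i" for r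
  proof -
    have "tag_word i r \<in> N" using N that by (auto simp: free_product_relators_def)
    then show ?thesis by (simp add: value_\<phi> one_presented_group wclass_eq_iff peq_relator)
  qed
  from Q.presented_group_universal[of ?\<phi> "R i" Xs, OF \<phi> this] obtain h where
    "h \<in> hom (presented_group (Xs, R i)) ?Q"
    "\<forall>w\<in>words Xs. h (wclass Xs (R i) w) = word_value ?Q ?\<phi> w" by blast
  then show thesis by (intro that[of h]) (simp_all add: value_\<phi>)
qed

lemma torsion_free_free_product_retraction:
  assumes tf: "torsion_free_on A (presented_group (Xs, R i))" and R: "R i \<subseteq> words Xs"
    and N: "N = torsion_free_relators A UNIV (free_product_relators R)"
  obtains k where "\<And>w. w \<in> words Xs \<Longrightarrow> k (wclass UNIV N (tag_word i w)) = wclass Xs (R i) w"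
proof -
  let ?G = "presented_group (Xs, R i)"
  interpret G: group ?G by (rule group_presented_group)
  define \<rho> where "\<rho> n = (if pfst n = i then generator_class Xs (R i) (psnd n) else \<one>\<^bsub>?G\<^esub>)" for n
  have \<rho>: "\<rho> n \<in> carrier ?G" for n by (simp add: \<rho>_def generator_class_in_carrier)
  have value_\<rho>: "word_value ?G \<rho> (tag_word i w) = wclass Xs (R i) w" if "w \<in> words Xs" for w
    using that by (simp add: word_value_tag_word \<rho>_def word_value_generator_class)
  have "word_value ?G \<rho> (tag_word j r) = \<one>\<^bsub>?G\<^esub>" if "r \<in> R j" for j r
  proof (cases "j = i")
    case True
    with that R have "r \<in> words Xs" "peq Xs (R i) r []" by (auto intro: peq_relator)
    with True show ?thesis by (simp add: value_\<rho> one_presented_group wclass_eq_iff)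
  qed (simp add: word_value_tag_word \<rho>_def G.word_value_one)
  then have trivial_on_relators: "word_value ?G \<rho> r = \<one>\<^bsub>?G\<^esub>" if "r \<in> free_product_relators R" for r
    using that by (auto simp: free_product_relators_def)
  have trivial_on_N: "word_value ?G \<rho> r = \<one>\<^bsub>?G\<^esub>" if "r \<in> N" for r
    by (rule G.word_value_torsion_free_relators[OF tf \<rho> trivial_on_relators that[unfolded N]])
  from G.presented_group_universal[of \<rho> N UNIV, OF \<rho> trivial_on_N] obtain k where
    "\<forall>w\<in>words UNIV. k (wclass UNIV N w) = word_value ?G \<rho> w" by blast
  then show thesis by (intro that[of k]) (simp add: value_\<rho>)
qed

theorem embeds_into_torsion_free_free_product:
  assumes "torsion_free_on A (presented_group (Xs, R i))" "R i \<subseteq> words Xs"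
  shows "embeds_into (presented_group (Xs, R i))
    (presented_group (UNIV, torsion_free_relators A UNIV (free_product_relators R)))"
proof -
  define N where "N = torsion_free_relators A UNIV (free_product_relators R)"
  have "free_product_relators R \<subseteq> N"
    unfolding N_def by (rule relators_subset_torsion_free_relators)
  then obtain h where h: "h \<in> hom (presented_group (Xs, R i)) (presented_group (UNIV, N))"
      "\<And>w. w \<in> words Xs \<Longrightarrow> h (wclass Xs (R i) w) = wclass UNIV N (tag_word i w)"
    by (rule free_product_inclusion) (rule that)
  obtain k where "\<And>w. w \<in> words Xs \<Longrightarrow> k (wclass UNIV N (tag_word i w)) = wclass Xs (R i) w"
    using assms N_def by (rule torsion_free_free_product_retraction) (rule that)
  with h(2) have "inj_on h (carrier (presented_group (Xs, R i)))"
    by (intro inj_on_inverseI[where g = k]) (auto simp: carrier_presented_group)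
  with h(1) show ?thesis unfolding embeds_into_def N_def by blast
qed

section \<open>Enumerability of the torsion-free relators\<close>

lemma enumerable_mem_re_set:
  assumes "re_set S" "recursive f"
  shows "enumerable (\<lambda>e. f e \<in> S)"
  using enumerable_subst1[of "\<lambda>n _. n \<in> S" f "\<lambda>i e. e i"] assms
  by (simp add: re_set_iff_enumerable recursive_var)

abbreviation letter_code :: "nat \<times> bool \<Rightarrow> nat" where
  "letter_code \<equiv> \<lambda>(x, b). prod_encode (x, if b then 1 else 0)"

lemma effective_word_code: "effective word_code"
proof -
  have "prod_encode (x, k) \<in> range letter_code \<longleftrightarrow> k = 0 \<or> k = 1" for x k
    by (auto simp: image_iff prod_encode_eq ex_bool_eq)
  from this[of "pfst n" "psnd n" for n]
  have "n \<in> range letter_code \<longleftrightarrow> psnd n = 0 \<or> psnd n = 1" for n by simp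
  moreover have "enumerable (\<lambda>e. psnd (e 0) = 0 \<or> psnd (e 0) = 1)"
    by (intro enumerable_intros recursive_intros)
  moreover have "inj letter_code"
    by (auto simp: inj_on_def prod_encode_eq split: if_splits)
  ultimately have "effective letter_code" by (simp add: effective_def)
  from effective_list[OF this] show ?thesis by (simp add: word_code_def[abs_def])
qed

lemma inj_word_code: "inj word_code"
  using effective_word_code by (simp add: effective_def)

lemma word_code_Nil: "word_code [] = 0"
  by (simp add: word_code_def)

lemma word_code_Cons:
  "word_code ((x, b) # w) = Suc (prod_encode (prod_encode (x, if b then 1 else 0), word_code w))"
  by (simp add: word_code_def)

lemma word_code_append:
  "word_code (u @ v) = list_encode (list_decode (word_code u) @ list_decode (word_code v))"
  by (simp add: word_code_def)

lemma word_code_wpow: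
  "word_code (wpow w n) =
    rec_nat 0 (\<lambda>_ r. list_encode (list_decode (word_code w) @ list_decode r)) n"
  by (induction n) (simp_all add: word_code_Nil word_code_append)

lemma word_code_tag_word:
  "word_code (tag_word i w) =
    foldr (\<lambda>l r. Suc (prod_encode (prod_encode (prod_encode (i, pfst l), psnd l), r)))
      (list_decode (word_code w)) 0"
  by (induction w) (auto simp: tag_word_def word_code_def)

inductive peq_rule ::
    "nat set \<Rightarrow> word list \<times> word \<times> word \<Rightarrow> (word list \<times> word \<times> word) list \<Rightarrow> bool"
  for Xs where
  peq_rule_refl: "peq_rule Xs (rs, w, w) []"
| peq_rule_sym: "peq_rule Xs (rs, v, u) [(rs, u, v)]"
| peq_rule_trans: "peq_rule Xs (rs, u, w) [(rs, u, v), (rs, v, w)]"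
| peq_rule_cancel: "x \<in> Xs \<Longrightarrow> peq_rule Xs (rs, u @ [(x, b), (x, \<not> b)] @ v, u @ v) []"
| peq_rule_rel: "r \<in> set rs \<Longrightarrow> peq_rule Xs (rs, u @ r @ v, u @ v) []"

lemma generated_peq_rule_iff: "generated (peq_rule Xs) (rs, u, v) \<longleftrightarrow> peq Xs (set rs) u v"
proof
  have "generated (peq_rule Xs) j \<Longrightarrow> case j of (rs, u, v) \<Rightarrow> peq Xs (set rs) u v" for j
  proof (induction rule: generated.induct)
    case (generated_rule j js)
    from generated_rule(1) show ?case
      using generated_rule(2)
      by cases (auto intro: peq_refl peq_sym peq_trans peq_cancel_Cons peq_rel)
  qed
  then show "generated (peq_rule Xs) (rs, u, v) \<Longrightarrow> peq Xs (set rs) u v" by blast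
next
  note step = generated_rule[of "peq_rule Xs"]
  assume "peq Xs (set rs) u v"
  then show "generated (peq_rule Xs) (rs, u, v)"
  proof (induction rule: peq.induct)
    case (peq_refl w)
    show ?case by (rule step[OF peq_rule_refl]) simp
  next
    case (peq_sym u v)
    then show ?case by (intro step[OF peq_rule_sym]) simp
  next
    case (peq_trans u v w)
    then show ?case by (intro step[OF peq_rule_trans]) simp
  next
    case (peq_cancel x u b v)
    then show ?case by (intro step[OF peq_rule_cancel]) simp_all
  next
    case (peq_rel r u v)
    then show ?case by (intro step[OF peq_rule_rel]) simp_all
  qed
qed

definition peq_code :: "word list \<times> word \<times> word \<Rightarrow> nat" where
  "peq_code = (\<lambda>(rs, u, v).
     prod_encode (list_code word_code rs, prod_encode (word_code u, word_code v)))"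

lemma inj_peq_code: "inj peq_code"
  by (auto simp: inj_on_def peq_code_def prod_encode_eq list_encode_eq inj_eq[OF inj_word_code]
    inj_map_eq_map[OF inj_word_code])

lemmas enumerable_ex_word = enumerable_ex_code[OF effective_word_code]
  enumerable_ex_code[OF effective_list[OF effective_word_code]]

lemma enumerable_mem_list [enumerable_intros]:
  assumes "recursive f" "recursive l"
  shows "enumerable (\<lambda>e. f e \<in> set (list_decode (l e)))"
proof -
  have "decidable (\<lambda>e. \<exists>x\<in>set (list_decode (l e)). x = f e)"
    by (intro decidable_bex_list recursive_intros recursive_shift assms)
  then show ?thesis by (intro enumerable_decidable) simp
qed

lemma enumerable_peq_rule:
  assumes "re_set Xs"
  shows "enumerable (\<lambda>e. coded_rule peq_code (peq_rule Xs) (e 0) (e (Suc 0)))"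
proof -
  have mem: "r \<in> set rs \<longleftrightarrow> word_code r \<in> set (list_decode (list_code word_code rs))" for r rs
    by (simp add: inj_image_mem_iff[OF inj_word_code])
  show ?thesis
    unfolding peq_rule.simps[abs_def] coded_rule_simps peq_code_def mem
      word_code_append word_code_Cons list.map list_encode.simps prod.case ex_bool_eq simp_thms
      if_True if_False
    by (intro enumerable_disj)
      (intro enumerable_intros enumerable_ex_word enumerable_mem_re_set[OF assms] recursive_intros)+
qed

lemma enumerable_peq:
  assumes "re_set Xs" "recursive l" "recursive f" "recursive g"
  shows "enumerable (\<lambda>e. \<exists>rs u v. l e = list_code word_code rs \<and> f e = word_code u \<and>
    g e = word_code v \<and> peq Xs (set rs) u v)"
proof -
  let ?S = "peq_code ` {j. generated (peq_rule Xs) j}"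
  have "re_set ?S"
    unfolding re_set_iff_enumerable
    by (intro enumerable_generated inj_peq_code enumerable_peq_rule assms)
  then have "enumerable (\<lambda>e. prod_encode (l e, prod_encode (f e, g e)) \<in> ?S)"
    by (intro enumerable_mem_re_set recursive_intros assms)
  moreover have "prod_encode (k, prod_encode (m, n)) \<in> ?S \<longleftrightarrow>
      (\<exists>rs u v. k = list_code word_code rs \<and> m = word_code u \<and> n = word_code v \<and>
        peq Xs (set rs) u v)" for k m n
    by (force simp: peq_code_def image_iff prod_encode_eq generated_peq_rule_iff)
  ultimately show ?thesis by simp
qed

lemma effective_int_encode: "effective int_encode"
  by (simp add: effective_def inj_int_encode surj_int_encode enumerable_decidable decidable_const)

lemma nat_abs_eq_int_encode: "nat \<bar>z\<bar> = Suc (int_encode z) div 2"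
  by (auto simp: int_encode_def sum_encode_def)

lemma recursive_div_2 [recursive_intros]:
  assumes "recursive f"
  shows "recursive (\<lambda>e. f e div 2)"
proof (rule recursive_if_decidable_graph)
  have "q = n div 2 \<longleftrightarrow> n = q + q \<or> n = Suc (q + q)" for q n :: nat by auto
  then show "decidable (\<lambda>e. e 0 = f (\<lambda>i. e (Suc i)) div 2)"
    by (simp only:) (intro recursive_intros recursive_shift assms)
qed

lemma enumerable_torsion_rule:
  assumes A: "re_int_set A" and Xs: "re_set Xs" and R: "re_set (word_code ` R)"
  shows "enumerable (\<lambda>e. coded_rule word_code (torsion_rule A Xs R) (e 0) (e (Suc 0)))"
proof -
  have mem_R: "r \<in> R \<longleftrightarrow> word_code r \<in> word_code ` R" for r
    by (simp add: inj_image_mem_iff[OF inj_word_code])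
  have mem_A: "z \<in> A \<longleftrightarrow> int_encode z \<in> int_encode ` A" for z
    by (simp add: inj_image_mem_iff[OF inj_int_encode])
  have mem_words: "w \<in> words Xs \<longleftrightarrow> (\<forall>l\<in>set (list_decode (word_code w)). pfst l \<in> Xs)" for w
    by (auto simp: words_def word_code_def)
  define P where "P k m n \<longleftrightarrow> (\<exists>rs u v. k = list_code word_code rs \<and> m = word_code u \<and>
    n = word_code v \<and> peq Xs (set rs) u v)" for k m n
  have peq: "peq Xs (set rs) u v \<longleftrightarrow> P (list_code word_code rs) (word_code u) (word_code v)"
    for rs u v
    by (auto simp: P_def list_encode_eq inj_eq[OF inj_word_code] inj_map_eq_map[OF inj_word_code])
  have P: "enumerable (\<lambda>e. P (l e) (f e) (g e))"
    if "recursive l" "recursive f" "recursive g" for l f g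
    unfolding P_def using Xs that by (rule enumerable_peq)
  show ?thesis
    unfolding torsion_rule.simps[abs_def] coded_rule_simps peq mem_R mem_A mem_words
      nat_abs_eq_int_encode word_code_wpow word_code_Nil list.map
    by (intro enumerable_disj)
      (intro enumerable_intros enumerable_ex_word enumerable_ex_code[OF effective_int_encode] P
        enumerable_ball_list enumerable_mem_re_set[OF Xs] enumerable_mem_re_set[OF R]
        enumerable_mem_re_set[OF A[unfolded re_int_set_def]] recursive_intros)+
qed

theorem cg_rec_presentation_torsion_free_relators:
  assumes "re_int_set A" "cg_rec_presentation (Xs, R)"
  shows "cg_rec_presentation (Xs, torsion_free_relators A Xs R)"
proof -
  from assms(2) have Xs: "re_set Xs" and R: "re_set (word_code ` R)" "R \<subseteq> words Xs"
    by (simp_all add: cg_rec_presentation_def)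
  have "enumerable (\<lambda>e. e 0 \<in> word_code ` torsion_free_relators A Xs R)"
    unfolding torsion_free_relators_def
    by (intro enumerable_generated inj_word_code enumerable_torsion_rule assms(1) Xs R(1))
  with Xs torsion_free_relators_subset_words[OF R(2)] show ?thesis
    by (simp add: cg_rec_presentation_def re_set_iff_enumerable)
qed

section \<open>The universal presentation\<close>

definition nth_relators :: "nat \<Rightarrow> word set" where
  "nth_relators i = {r. word_code r \<in> nth_re_set i}"

lemma cg_rec_presentation_free_product_relators:
  "cg_rec_presentation (UNIV, free_product_relators nth_relators)"
proof -
  have "re_set UNIV"
    by (simp add: re_set_iff_enumerable enumerable_decidable decidable_const)
  moreover have "n \<in> word_code ` free_product_relators nth_relators \<longleftrightarrow>
      (\<exists>i r. n = word_code (tag_word i r) \<and> word_code r \<in> nth_re_set i)" for n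
    by (auto simp: free_product_relators_def nth_relators_def)
  then have "re_set (word_code ` free_product_relators nth_relators)"
    unfolding re_set_iff_enumerable
    by (simp only: word_code_tag_word) (intro enumerable_intros enumerable_ex_word recursive_intros)
  ultimately show ?thesis by (simp add: cg_rec_presentation_def)
qed

lemma cg_rec_presentation_imp_nth_relators:
  assumes "cg_rec_presentation (Xs, R)"
  obtains i where "R = nth_relators i"
proof -
  from assms obtain i where "word_code ` R = nth_re_set i"
    by (auto simp: cg_rec_presentation_def elim: re_set_imp_nth_re_set)
  then have "word_code r \<in> nth_re_set i \<longleftrightarrow> r \<in> R" for r
    by (metis inj_image_mem_iff[OF inj_word_code])
  then show thesis by (intro that[of i]) (simp add: nth_relators_def)
qed

definition universal_presentation :: "int set \<Rightarrow> presentation" where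
  "universal_presentation A =
     (UNIV, torsion_free_relators A UNIV (free_product_relators nth_relators))"

lemma presented_group_embeds_into_universal:
  assumes "cg_rec_presentation P" "torsion_free_on A (presented_group P)"
  shows "embeds_into (presented_group P) (presented_group (universal_presentation A))"
proof -
  obtain Xs R where P: "P = (Xs, R)" by (cases P)
  with assms(1) obtain i where R: "R = nth_relators i"
    by (auto elim: cg_rec_presentation_imp_nth_relators)
  have "nth_relators i \<subseteq> words Xs" using assms(1) by (simp add: P R cg_rec_presentation_def)
  with assms(2) show ?thesis
    unfolding P R universal_presentation_def by (intro embeds_into_torsion_free_free_product)
qed

lemma embeds_into_trans: "embeds_into G H \<Longrightarrow> embeds_into H K \<Longrightarrow> embeds_into G K"
  unfolding embeds_into_def by (meson Group.hom_compose comp_inj_on hom_carrier inj_on_subset)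

lemma is_iso_imp_embeds_into: "G \<cong> H \<Longrightarrow> embeds_into G H"
  by (auto simp: is_iso_def iso_def bij_betw_def embeds_into_def)

lemma torsion_free_on_embeds_into:
  assumes "group G" "group H" "embeds_into H G" "torsion_free_on A G"
  shows "torsion_free_on A H"
proof -
  obtain h where h: "h \<in> hom H G" "inj_on h (carrier H)"
    using assms(3) by (auto simp: embeds_into_def)
  interpret group_hom H G h
    using assms h(1) by (simp add: group_hom_def group_hom_axioms_def)
  have "g = \<one>\<^bsub>H\<^esub>" if "g \<in> carrier H" "z \<in> A" "g [^]\<^bsub>H\<^esub> z = \<one>\<^bsub>H\<^esub>" for g and z :: int
  proof -
    have "h g [^]\<^bsub>G\<^esub> z = \<one>\<^bsub>G\<^esub>" using hom_int_pow[OF that(1), of z] that(3) by simp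
    with that assms(4) have "h g = h \<one>\<^bsub>H\<^esub>" by (auto simp: torsion_free_on_def)
    then show ?thesis by (rule inj_onD[OF h(2)]) (use that in simp_all)
  qed
  then show ?thesis by (auto simp: torsion_free_on_def)
qed

lemma embeds_into_universal:
  assumes "group G" "cg_rec_presentable G" "torsion_free_on A G"
  shows "embeds_into G (presented_group (universal_presentation A))"
proof -
  obtain P where P: "cg_rec_presentation P" "G \<cong> presented_group P"
    using assms(2) unfolding cg_rec_presentable_def by blast
  have "group (presented_group P)" by (cases P) (simp add: group_presented_group)
  with assms(1) have "torsion_free_on A (presented_group P)"
    using is_iso_imp_embeds_into[OF group.iso_sym[OF assms(1) P(2)]] assms(3)
    by (rule torsion_free_on_embeds_into)
  with P(1) have "embeds_into (presented_group P) (presented_group (universal_presentation A))"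
    by (rule presented_group_embeds_into_universal)
  with is_iso_imp_embeds_into[OF P(2)] show ?thesis by (rule embeds_into_trans)
qed

theorem theorem2p9:
  fixes A :: "int set"
  assumes "re_int_set A"
  shows "\<exists>Q. cg_rec_presentation Q \<and> torsion_free_on A (presented_group Q) \<and>
    (\<forall>P. cg_rec_presentation P \<and> torsion_free_on A (presented_group P)
         \<longrightarrow> embeds_into (presented_group P) (presented_group Q)) \<and>
    (\<forall>G :: ('g, 'b) monoid_scheme. group G \<and> cg_rec_presentable G \<and> torsion_free_on A G
         \<longrightarrow> embeds_into G (presented_group Q))"
proof (intro exI conjI allI impI; (elim conjE)?)
  show "cg_rec_presentation (universal_presentation A)"
    unfolding universal_presentation_def
    using assms cg_rec_presentation_free_product_relators
    by (rule cg_rec_presentation_torsion_free_relators)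
  show "torsion_free_on A (presented_group (universal_presentation A))"
    unfolding universal_presentation_def by (rule torsion_free_on_torsion_free_relators)
qed (fact presented_group_embeds_into_universal embeds_into_universal)+

end
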